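(* Let $\mathcal B$ be an approximable interpretation basis. For any net $S$ and any sequent $\Gamma$: if $S\vdash_{\mathsf{MLL}^\maltese}\Gamma$ (i.e. $S$ represents an $\mathsf{MLL}^\maltese$ proof of $\Gamma$), then $S\in[\![\Gamma]\!]_{\mathcal B}$ (i.e. $S$ realises $\Gamma$ with respect to $\mathcal B$).
   Context: **Nets.** Fix a countable set of positions. A hypergraph has a finite set $V$ of positions and a finite set $E$ of labelled links; each link has a source and a target, which are finite sequences of pairwise distinct positions, the source and the target being disjoint. The only links used are: tensor links $\langle p_1,p_2\rhd_\otimes p\rangle$ and par links $\langle p_1,p_2\rhd_\wp p\rangle$ (two inputs, one output), cut links $\langle p_1,p_2\rhd_{\mathsf{cut}}\rangle$ (two inputs, no output), and daimon links $\langle\rhd_\maltese p_1,\dots,p_n\rangle$, $n\ge 0$ (no input). ($\wp$ denotes the par connective.) The sum $H_1+H_2$ takes the union of positions and the disjoint union of links. A conclusion is a position that is in the source of no link. A (multiplicative) net $S$ is a finite sum of such links in which every position is in the target of exactly one link and in the source of at most one link, together with a total order on its conclusions; $S(i)$ is the $i$-th conclusion and $\#S$ the number of conclusions. Nets are considered up to isomorphism. $S\parallel T$ is the disjoint union (after renaming positions), with the conclusions of $S$ ordered before those of $T$. $\maltese_n$ is the net made of one daimon link with $n$ outputs. **Cut elimination** $\to$ is the closure under sum with a context of the following rules (insensitive to the order of the inputs of cut links; conclusions and their order are unchanged): (i) $\langle p_1,p_2\rhd_\wp p\rangle+\langle p,q\rhd_{\mathsf{cut}}\rangle+\langle q_1,q_2\rhd_\otimes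 q\rangle\to\langle p_1,q_1\rhd_{\mathsf{cut}}\rangle+\langle p_2,q_2\rhd_{\mathsf{cut}}\rangle$; (ii) for two distinct daimon links, $\langle\rhd_\maltese\bar p\rangle+\langle p_i,q_j\rhd_{\mathsf{cut}}\rangle+\langle\rhd_\maltese\bar q\rangle\to\langle\rhd_\maltese\bar p\setminus p_i,\bar q\setminus q_j\rangle$; (iii) $\langle p_1,p_2\rhd_\otimes p\rangle+\langle p,q\rhd_{\mathsf{cut}}\rangle+\langle\rhd_\maltese\bar a,q,\bar b\rangle\to\langle p_1,q^1\rhd_{\mathsf{cut}}\rangle+\langle p_2,q^2\rhd_{\mathsf{cut}}\rangle+\langle\rhd_\maltese\bar a,q^1,q^2,\bar b\rangle$ with $q^1,q^2$ fresh; (iv) $\langle q_1,q_2\rhd_\wp q\rangle+\langle q,p\rhd_{\mathsf{cut}}\rangle+\langle\rhd_\maltese\bar a,p,\bar b\rangle\to\langle q_1,p^1\rhd_{\mathsf{cut}}\rangle+\langle q_2,p^2\rhd_{\mathsf{cut}}\rangle+\langle\rhd_\maltese\bar a',p^1,\bar b'\rangle+\langle\rhd_\maltese\bar a'',p^2,\bar b''\rangle$ with $p^1,p^2$ fresh, for any choice of sequences such that $\bar a',\bar a''$ enumerate a splitting of $\bar a$ into two (possibly empty) parts and $\bar b',\bar b''$ one of $\bar b$. In (iii) and (iv) the inputs of the connective link may themselves be outputs of the daimon link involved. Other cuts are not reducible. $\to^*$ is the reflexive transitive closure. **Orthogonality and types.** For nets $S,T$ with $k=\min(\#S,\#T)$,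 the interaction $S::T$ is $S+T+\sum_{1\le i\le k}\langle S(i),T(i)\rhd_{\mathsf{cut}}\rangle$ ($S,T$ made disjoint), the remaining conclusions keeping their order. $S\perp T$ iff there exists a reduction $S::T\to^*\maltese_0$. For a set $A$ of nets, $A^\bot=\{P\mid\forall R\in A,\ P\perp R\}$; a type is a set $\mathbf A$ with $\mathbf A^{\bot\bot}=\mathbf A$. If $\mathbf A,\mathbf A^\bot$ are nonempty, all their nets have the same number of conclusions, written $\#\mathbf A$; otherwise the condition $\#S\ge\#\mathbf A$ below is read as vacuous. Define $\mathbf A\rightthreetimes\mathbf B=\{S\mid \forall T\in\mathbf A^\bot,\ S::T\in\mathbf B,\text{ and }\#S\ge\#\mathbf A\}$, $\mathbf A\parallel\mathbf B=\{S\parallel T\mid S\in\mathbf A,T\in\mathbf B\}^{\bot\bot}$, and, for types whose nets have one conclusion and $p$ a fresh position, $\mathbf A\otimes\mathbf B=\{S+\langle S(1),S(2)\rhd_\otimes p\rangle\mid S\in\mathbf A\parallel\mathbf B\}^{\bot\bot}$, $\mathbf A\wp\mathbf B=\{S+\langle S(1),S(2)\rhd_\wp p\rangle\mid S\in\mathbf A\rightthreetimes\mathbf B\}^{\bot\bot}$. **Logic.** Propositional variables form a countable set with an involution $X\mapsto X^\bot$. Formulas: $A,B::=X\mid A\wp B\mid A\otimes B$, with $(A\wp B)^\bot=A^\bot\otimes B^\bot$, $(A\otimes B)^\bot=A^\bot\wp B^\bot$. Sequents are finite sequences of formulas. $\mathsf{MLL}^\maltese$ proofs are trees built with the rules: ($\maltese$)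 infer any $\Gamma$ with no premise; ($\wp$) from $\Gamma,A,B$ infer $\Gamma,A\wp B$; ($\otimes$) from $\Gamma,A$ and $\Delta,B$ infer $\Gamma,\Delta,A\otimes B$; (cut) from $\Gamma,A$ and $\Delta,A^\bot$ infer $\Gamma,\Delta$; (ex) exchange of two consecutive formulas. A net $S$ represents a proof $\pi$ of $A_1,\dots,A_n$ (the $i$-th conclusion of $S$ corresponding to $A_i$), inductively: a $\maltese$-rule is represented by a single daimon link $\langle\rhd_\maltese p_1,\dots,p_n\rangle$ with conclusions ordered $p_1,\dots,p_n$; a $\wp$-rule by adding a par link with fresh output to the conclusions for $A,B$ of a net representing the premise; a $\otimes$-rule (resp. cut-rule) by the disjoint sum of nets representing the premises plus a tensor link with fresh output (resp. a cut link) on the conclusions for the two active formulas; exchange by exchanging the two conclusions in the order. $S\vdash_{\mathsf{MLL}^\maltese}\Gamma$ means that $S$ represents some $\mathsf{MLL}^\maltese$ proof of $\Gamma$. **Interpretation.** An interpretation basis $\mathcal B$ associates to each propositional variable $X$ a type $[\![X]\!]_{\mathcal B}$ all of whose nets have one conclusion, with $[\![X^\bot]\!]_{\mathcal B}\subseteq[\![X]\!]_{\mathcal B}^\bot$ for all $X$. It is extended by $[\![A\otimes B]\!]_{\mathcal B}=[\![A]\!]_{\mathcal B}\otimes[\![B]\!]_{\mathcal B}$, $[\![A\wp B]\!]_{\mathcal B}=[\![A]\!]_{\mathcal B}\wp[\![B]\!]_{\mathcal B}$, and for a sequent $[\![A_1,\dots,A_n]\!]_{\mathcal B}=[\![A_1]\!]_{\mathcal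 B}\rightthreetimes\cdots\rightthreetimes[\![A_n]\!]_{\mathcal B}$ ($\rightthreetimes$ is associative on types). $\mathcal B$ is approximable if $\maltese_1\in[\![X]\!]_{\mathcal B}$ for every propositional variable $X$. *)

theory Defs
  imports "HOL-Library.Multiset" "HOL-Library.Countable"
begin

section \<open>Nets\<close>

datatype 'p link =
    TensorL 'p 'p 'p   \<comment> \<open>two inputs, then the output\<close>
  | ParL 'p 'p 'p      \<comment> \<open>two inputs, then the output\<close>
  | CutL 'p 'p
  | DaimonL "'p list"

fun source :: "'p link \<Rightarrow> 'p list" where
  "source (TensorL p1 p2 p) = [p1, p2]"
| "source (ParL p1 p2 p) = [p1, p2]"
| "source (CutL p1 p2) = [p1, p2]"
| "source (DaimonL ps) = []"

fun target :: "'p link \<Rightarrow> 'p list" where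
  "target (TensorL p1 p2 p) = [p]"
| "target (ParL p1 p2 p) = [p]"
| "target (CutL p1 p2) = []"
| "target (DaimonL ps) = ps"

definition positions :: "'p link multiset \<Rightarrow> 'p set" where
  "positions H = (\<Union>l\<in>set_mset H. set (source l) \<union> set (target l))"

text \<open>
  Positions are natural numbers. The links form a multiset because the sum takes the disjoint
  union of links: a net may contain several copies of the daimon link without outputs.
  In a net every position is in the target of some link, so the set of positions
  is determined by the links. The ordered conclusions are listed explicitly.
\<close>

datatype net = Net (links: "nat link multiset") (concl: "nat list")

definition is_net :: "net \<Rightarrow> bool" where
  "is_net S \<longleftrightarrow>
     (\<forall>l\<in>#links S. distinct (source l @ target l)) \<and>
     (\<forall>p\<in>positions (links S).
        size {#l \<in># links S. p \<in> set (target l)#} = 1 \<and>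
        size {#l \<in># links S. p \<in> set (source l)#} \<le> 1) \<and>
     distinct (concl S) \<and>
     set (concl S) = {p \<in> positions (links S). \<forall>l\<in>#links S. p \<notin> set (source l)}"

abbreviation nconcl :: "net \<Rightarrow> nat" where
  "nconcl S \<equiv> length (concl S)"

definition rename :: "(nat \<Rightarrow> nat) \<Rightarrow> net \<Rightarrow> net" where
  "rename f S = Net (image_mset (map_link f) (links S)) (map f (concl S))"

text \<open>
  A bijection between two finite sets of positions extends to a permutation of
  all positions, so isomorphisms may be taken to be such permutations.
\<close>

definition net_iso :: "net \<Rightarrow> net \<Rightarrow> bool" where
  "net_iso S T \<longleftrightarrow> (\<exists>f. bij f \<and> T = rename f S)"

definition daimon :: "nat \<Rightarrow> net" where
  "daimon n = Net {#DaimonL [0..<n]#} [0..<n]"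

text \<open>
  The two sides of a binary operation are made disjoint by moving one to the even
  and the other to the odd positions.
\<close>

abbreviation to_left :: "net \<Rightarrow> net" where
  "to_left \<equiv> rename (\<lambda>n. 2 * n)"

abbreviation to_right :: "net \<Rightarrow> net" where
  "to_right \<equiv> rename (\<lambda>n. 2 * n + 1)"

definition parallel :: "net \<Rightarrow> net \<Rightarrow> net" where
  "parallel S T =
     Net (links (to_left S) + links (to_right T)) (concl (to_left S) @ concl (to_right T))"

definition interaction :: "net \<Rightarrow> net \<Rightarrow> net" where
  "interaction S T =
     (let S' = to_left S; T' = to_right T; k = min (nconcl S) (nconcl T)
      in Net (links S' + links T' + mset (map2 CutL (take k (concl S')) (take k (concl T'))))
             (drop k (concl S') @ drop k (concl T')))"


section \<open>Cut elimination\<close>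

text \<open>
  The multiset \<open>H\<close> is the context. Fresh positions are fresh for the whole hypergraph.
\<close>

inductive cut_step :: "'p link multiset \<Rightarrow> 'p link multiset \<Rightarrow> bool" where
  par_tensor:
    "c \<in> {CutL p q, CutL q p} \<Longrightarrow>
     cut_step (H + {#ParL p1 p2 p, c, TensorL q1 q2 q#})
              (H + {#CutL p1 q1, CutL p2 q2#})"
| daimon_daimon:
    "c \<in> {CutL p q, CutL q p} \<Longrightarrow>
     cut_step (H + {#DaimonL (as @ p # bs), c, DaimonL (cs @ q # ds)#})
              (H + {#DaimonL (as @ bs @ cs @ ds)#})"
| tensor_daimon:
    "c \<in> {CutL p q, CutL q p} \<Longrightarrow>
     L = H + {#TensorL p1 p2 p, c, DaimonL (as @ q # bs)#} \<Longrightarrow>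
     q1 \<notin> positions L \<Longrightarrow> q2 \<notin> positions L \<Longrightarrow> q1 \<noteq> q2 \<Longrightarrow>
     cut_step L (H + {#CutL p1 q1, CutL p2 q2, DaimonL (as @ [q1, q2] @ bs)#})"
| par_daimon:
    "c \<in> {CutL q p, CutL p q} \<Longrightarrow>
     L = H + {#ParL q1 q2 q, c, DaimonL (as @ p # bs)#} \<Longrightarrow>
     p1 \<notin> positions L \<Longrightarrow> p2 \<notin> positions L \<Longrightarrow> p1 \<noteq> p2 \<Longrightarrow>
     mset as = mset as1 + mset as2 \<Longrightarrow> mset bs = mset bs1 + mset bs2 \<Longrightarrow>
     cut_step L (H + {#CutL q1 p1, CutL q2 p2,
                       DaimonL (as1 @ p1 # bs1), DaimonL (as2 @ p2 # bs2)#})"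

definition net_step :: "net \<Rightarrow> net \<Rightarrow> bool" where
  "net_step S T \<longleftrightarrow> cut_step (links S) (links T) \<and> concl T = concl S"


section \<open>Orthogonality and types\<close>

definition orth :: "net \<Rightarrow> net \<Rightarrow> bool" where
  "orth S T \<longleftrightarrow> net_step\<^sup>*\<^sup>* (interaction S T) (daimon 0)"

definition polar :: "net set \<Rightarrow> net set" where
  "polar A = {P. is_net P \<and> (\<forall>R\<in>A. orth P R)}"

definition is_type :: "net set \<Rightarrow> bool" where
  "is_type A \<longleftrightarrow> polar (polar A) = A"

definition type_arity :: "net set \<Rightarrow> nat" where
  "type_arity A = (THE n. \<forall>R\<in>A. nconcl R = n)"

definition comp_type :: "net set \<Rightarrow> net set \<Rightarrow> net set" where
  "comp_type A B =
     {S. is_net S \<and> (\<forall>T\<in>polar A. interaction S T \<in> B) \<and>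
         (A \<noteq> {} \<and> polar A \<noteq> {} \<longrightarrow> type_arity A \<le> nconcl S)}"

definition parallel_type :: "net set \<Rightarrow> net set \<Rightarrow> net set" where
  "parallel_type A B = polar (polar {parallel S T |S T. S \<in> A \<and> T \<in> B})"

definition tensor_type :: "net set \<Rightarrow> net set \<Rightarrow> net set" where
  "tensor_type A B = polar (polar
     {Net (add_mset (TensorL p1 p2 p) (links S)) (p # ps) |S p1 p2 ps p.
        S \<in> parallel_type A B \<and> concl S = p1 # p2 # ps \<and> p \<notin> positions (links S)})"

definition par_type :: "net set \<Rightarrow> net set \<Rightarrow> net set" where
  "par_type A B = polar (polar
     {Net (add_mset (ParL p1 p2 p) (links S)) (p # ps) |S p1 p2 ps p.
        S \<in> comp_type A B \<and> concl S = p1 # p2 # ps \<and> p \<notin> positions (links S)})"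

text \<open>
  Nets are meant up to isomorphism. Working with concrete nets is harmless, because the
  polar of any set is closed under isomorphism; in particular so is every type.
\<close>

lemma positions_rename:
  "positions (image_mset (map_link f) H) = f ` positions H"
proof -
  have "set (source (map_link f l)) \<union> set (target (map_link f l))
      = f ` (set (source l) \<union> set (target l))" for l
    by (cases l) auto
  then show ?thesis unfolding positions_def by auto
qed

lemma map_source_target:
  "source (map_link f l) = map f (source l)" "target (map_link f l) = map f (target l)"
  by (cases l; simp)+

lemma cut_step_rename:
  assumes "inj f" "cut_step L R"
  shows "cut_step (image_mset (map_link f) L) (image_mset (map_link f) R)"
  using assms(2)
proof cases
  case (par_tensor c p q H p1 p2 q1 q2)
  then show ?thesis
    using cut_step.par_tensor[of "map_link f c" "f p" "f q" "image_mset (map_link f) H"]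
    by auto
next
  case (daimon_daimon c p q H as bs cs ds)
  then show ?thesis
    using cut_step.daimon_daimon[of "map_link f c" "f p" "f q" "image_mset (map_link f) H"
        "map f as" "map f bs" "map f cs" "map f ds"]
    by auto
next
  case (tensor_daimon c p q H p1 p2 as bs q1 q2)
  let ?H = "image_mset (map_link f) H" and ?L = "image_mset (map_link f) L"
  have c: "map_link f c \<in> {CutL (f p) (f q), CutL (f q) (f p)}"
    using tensor_daimon(2) by auto
  have L: "?L = ?H + {#TensorL (f p1) (f p2) (f p), map_link f c,
      DaimonL (map f as @ f q # map f bs)#}"
    by (simp add: tensor_daimon(3))
  have "f q1 \<notin> positions ?L" "f q2 \<notin> positions ?L" "f q1 \<noteq> f q2"
    using tensor_daimon(4-6) assms(1) by (simp_all add: positions_rename inj_image_mem_iff inj_eq)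
  from cut_step.tensor_daimon[OF c L this] show ?thesis
    by (simp add: tensor_daimon(1))
next
  case (par_daimon c q p H q1 q2 as bs p1 p2 as1 as2 bs1 bs2)
  let ?H = "image_mset (map_link f) H" and ?L = "image_mset (map_link f) L"
  have c: "map_link f c \<in> {CutL (f q) (f p), CutL (f p) (f q)}"
    using par_daimon(2) by auto
  have L: "?L = ?H + {#ParL (f q1) (f q2) (f q), map_link f c,
      DaimonL (map f as @ f p # map f bs)#}"
    by (simp add: par_daimon(3))
  have "f p1 \<notin> positions ?L" "f p2 \<notin> positions ?L" "f p1 \<noteq> f p2"
    using par_daimon(4-6) assms(1) by (simp_all add: positions_rename inj_image_mem_iff inj_eq)
  moreover have "mset (map f as) = mset (map f as1) + mset (map f as2)"
    "mset (map f bs) = mset (map f bs1) + mset (map f bs2)"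
    by (simp_all add: par_daimon(7,8))
  ultimately show ?thesis
    using cut_step.par_daimon[OF c L] by (simp add: par_daimon(1))
qed

lemma net_steps_rename:
  assumes "inj f" "net_step\<^sup>*\<^sup>* S T"
  shows "net_step\<^sup>*\<^sup>* (rename f S) (rename f T)"
  using assms(2)
proof induction
  case (step T U)
  then have "net_step (rename f T) (rename f U)"
    using cut_step_rename[OF assms(1)] by (simp add: net_step_def rename_def)
  with step show ?case by simp
qed simp

lemma interaction_rename:
  obtains g where "bij f \<Longrightarrow> bij g" "interaction (rename f S) T = rename g (interaction S T)"
proof
  define g where "g n = (if even n then 2 * f (n div 2) else n)" for n :: nat
  have g: "g (2 * n) = 2 * f n" "g (Suc (2 * n)) = Suc (2 * n)" for n
    by (auto simp: g_def)
  show "interaction (rename f S) T = rename g (interaction S T)"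
    by (auto simp: interaction_def rename_def Let_def multiset.map_comp link.map_comp comp_def
        take_map drop_map zip_map1 zip_map2 case_prod_unfold g
        simp flip: mset_map intro!: arg_cong[of _ _ mset])
  show "bij g" if "bij f"
  proof (rule o_bij)
    define h where "h n = (if even n then 2 * inv f (n div 2) else n)" for n :: nat
    show "h \<circ> g = id" "g \<circ> h = id"
      using that by (auto simp: g_def h_def fun_eq_iff bij_is_inj bij_is_surj surj_f_inv_f)
  qed
qed

lemma is_net_rename:
  assumes "inj f" "is_net S"
  shows "is_net (rename f S)"
proof -
  have "{#l \<in># image_mset (map_link f) H. f p \<in> set (target l)#}
      = image_mset (map_link f) {#l \<in># H. p \<in> set (target l)#}" for p H
    using assms(1) by (simp add: filter_mset_image_mset map_source_target inj_image_mem_iff)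
  moreover have "{#l \<in># image_mset (map_link f) H. f p \<in> set (source l)#}
      = image_mset (map_link f) {#l \<in># H. p \<in> set (source l)#}" for p H
    using assms(1) by (simp add: filter_mset_image_mset map_source_target inj_image_mem_iff)
  moreover have "inj_on f X" for X
    using assms(1) by (rule inj_on_subset) simp
  ultimately show ?thesis
    using assms
    by (auto simp: is_net_def rename_def positions_rename map_source_target distinct_map
        inj_image_mem_iff inj_eq disjoint_iff)
qed

lemma polar_iso:
  assumes "P \<in> polar A" "net_iso P Q"
  shows "Q \<in> polar A"
proof -
  from assms(2) obtain f where f: "bij f" "Q = rename f P"
    by (auto simp: net_iso_def)
  have "orth Q R" if "orth P R" for R
  proof -
    obtain g where g: "bij g" "interaction Q R = rename g (interaction P R)"
      using interaction_rename[of f P R] f by metis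
    have "rename g (daimon 0) = daimon 0"
      by (simp add: rename_def daimon_def)
    with net_steps_rename[of g "interaction P R" "daimon 0"] that g show ?thesis
      by (simp add: orth_def bij_is_inj)
  qed
  with assms(1) f show ?thesis
    by (auto simp: polar_def is_net_rename bij_is_inj)
qed


section \<open>Multiplicative linear logic with daimon\<close>

datatype 'v form = Var 'v | Par "'v form" "'v form" | Tensor "'v form" "'v form"

text \<open>The parameter \<open>dual\<close> is the involution on propositional variables.\<close>

fun neg :: "('v \<Rightarrow> 'v) \<Rightarrow> 'v form \<Rightarrow> 'v form" where
  "neg dual (Var X) = Var (dual X)"
| "neg dual (Par A B) = Tensor (neg dual A) (neg dual B)"
| "neg dual (Tensor A B) = Par (neg dual A) (neg dual B)"

text \<open>The number in an exchange rule tells how many formulas precede the two exchanged ones.\<close>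

datatype 'v mll_proof =
    DaimonR "'v form list"
  | ParR "'v mll_proof"
  | TensorR "'v mll_proof" "'v mll_proof"
  | CutR "'v mll_proof" "'v mll_proof"
  | ExR nat "'v mll_proof"

inductive proof_of :: "('v \<Rightarrow> 'v) \<Rightarrow> 'v mll_proof \<Rightarrow> 'v form list \<Rightarrow> bool"
  for dual :: "'v \<Rightarrow> 'v" where
  daimon: "proof_of dual (DaimonR \<Gamma>) \<Gamma>"
| par: "proof_of dual \<pi> (\<Gamma> @ [A, B]) \<Longrightarrow> proof_of dual (ParR \<pi>) (\<Gamma> @ [Par A B])"
| tensor: "proof_of dual \<pi> (\<Gamma> @ [A]) \<Longrightarrow> proof_of dual \<rho> (\<Delta> @ [B]) \<Longrightarrow>
     proof_of dual (TensorR \<pi> \<rho>) (\<Gamma> @ \<Delta> @ [Tensor A B])"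
| cut: "proof_of dual \<pi> (\<Gamma> @ [A]) \<Longrightarrow> proof_of dual \<rho> (\<Delta> @ [neg dual A]) \<Longrightarrow>
     proof_of dual (CutR \<pi> \<rho>) (\<Gamma> @ \<Delta>)"
| ex: "proof_of dual \<pi> (\<Gamma> @ [A, B] @ \<Delta>) \<Longrightarrow>
     proof_of dual (ExR (length \<Gamma>) \<pi>) (\<Gamma> @ [B, A] @ \<Delta>)"

text \<open>
  Disjoint representatives and fresh positions are arbitrary here, so that the relation is
  closed under isomorphism of nets.
\<close>

inductive represents :: "net \<Rightarrow> 'v mll_proof \<Rightarrow> bool" where
  daimon: "distinct ps \<Longrightarrow> length ps = length \<Gamma> \<Longrightarrow>
     represents (Net {#DaimonL ps#} ps) (DaimonR \<Gamma>)"
| par: "represents S \<pi> \<Longrightarrow> concl S = ps @ [p1, p2] \<Longrightarrow> p \<notin> positions (links S) \<Longrightarrow>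
     represents (Net (add_mset (ParL p1 p2 p) (links S)) (ps @ [p])) (ParR \<pi>)"
| tensor: "represents S \<pi> \<Longrightarrow> represents T \<rho> \<Longrightarrow>
     positions (links S) \<inter> positions (links T) = {} \<Longrightarrow>
     concl S = ps @ [p1] \<Longrightarrow> concl T = qs @ [p2] \<Longrightarrow>
     p \<notin> positions (links S) \<union> positions (links T) \<Longrightarrow>
     represents (Net (add_mset (TensorL p1 p2 p) (links S + links T)) (ps @ qs @ [p]))
       (TensorR \<pi> \<rho>)"
| cut: "represents S \<pi> \<Longrightarrow> represents T \<rho> \<Longrightarrow>
     positions (links S) \<inter> positions (links T) = {} \<Longrightarrow>
     concl S = ps @ [p1] \<Longrightarrow> concl T = qs @ [p2] \<Longrightarrow>
     represents (Net (add_mset (CutL p1 p2) (links S + links T)) (ps @ qs)) (CutR \<pi> \<rho>)"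
| ex: "represents S \<pi> \<Longrightarrow> concl S = ps @ [p1, p2] @ qs \<Longrightarrow>
     represents (Net (links S) (ps @ [p2, p1] @ qs)) (ExR (length ps) \<pi>)"

definition mll_daimon :: "('v \<Rightarrow> 'v) \<Rightarrow> net \<Rightarrow> 'v form list \<Rightarrow> bool" where
  "mll_daimon dual S \<Gamma> \<longleftrightarrow> (\<exists>\<pi>. proof_of dual \<pi> \<Gamma> \<and> represents S \<pi>)"


section \<open>Interpretation\<close>

definition interpretation_basis :: "('v \<Rightarrow> 'v) \<Rightarrow> ('v \<Rightarrow> net set) \<Rightarrow> bool" where
  "interpretation_basis dual \<B> \<longleftrightarrow>
     (\<forall>X. is_type (\<B> X) \<and> (\<forall>S\<in>\<B> X. nconcl S = 1) \<and> \<B> (dual X) \<subseteq> polar (\<B> X))"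

definition approximable :: "('v \<Rightarrow> net set) \<Rightarrow> bool" where
  "approximable \<B> \<longleftrightarrow> (\<forall>X. daimon 1 \<in> \<B> X)"

fun interp :: "('v \<Rightarrow> net set) \<Rightarrow> 'v form \<Rightarrow> net set" where
  "interp \<B> (Var X) = \<B> X"
| "interp \<B> (Tensor A B) = tensor_type (interp \<B> A) (interp \<B> B)"
| "interp \<B> (Par A B) = par_type (interp \<B> A) (interp \<B> B)"

text \<open>
  The empty sequent is interpreted by the neutral element of \<^const>\<open>comp_type\<close> on types, the polar of
  the empty net, that is, the set of nets that reduce to \<^term>\<open>daimon 0\<close>.
\<close>

fun interp_seq :: "('v \<Rightarrow> net set) \<Rightarrow> 'v form list \<Rightarrow> net set" where
  "interp_seq \<B> [] = polar {Net {#} []}"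
| "interp_seq \<B> [A] = interp \<B> A"
| "interp_seq \<B> (A # B # \<Gamma>) = comp_type (interp \<B> A) (interp_seq \<B> (B # \<Gamma>))"

end

theory Submission
  imports Defs
begin

text \<open>
  A net realises \<open>A\<^sub>1, \<dots>, A\<^sub>n\<close> iff, cut against arbitrary nets of the polars of all the
  \<open>A\<^sub>i\<close>, it reduces to the daimon without outputs. With this description exchange is
  immediate, and the rules for \<open>\<wp>\<close>, \<open>\<otimes>\<close> and cut follow by first plugging the tests for the
  context, which leaves a net with only the active conclusions; the cut rule moreover uses
  that the interpretation of the negation of \<open>A\<close> lies in the polar of that of \<open>A\<close>, by induction on \<open>A\<close>.

  For the daimon rule, reductions of a daimon with one output against each test merge into a
  single reduction. So one needs that every formula is realised by the daimon with one output.
  This is a simulation: a test that succeeds on two daimons joined by a tensor link, or on a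
  binary daimon closed by a par link, also succeeds on the daimon with one output. The
  simulation in turn rests on the fact that contracting a cut between two daimons loses no
  successful reduction.
\<close>


section \<open>Hypergraphs up to the order of cuts and daimons\<close>

text \<open>The obstacle is that reduction is not confluent: cutting a par link against a daimon
  involves a free choice of splitting, so two nets with a common reduct need not have the same
  successful reductions. Every transfer of success from one net to another is therefore an induction
  on one given successful reduction, and \<open>collapses\<close> presents success as backward
  closure to make these inductions direct. Contraction enters as follows. A tensor link over two
  unary daimons, cut against a daimon, leaves two cuts on freshly created positions, where the unary
  daimon has just one cut that disappears. The two can be compared only if those extra cuts can be
  removed from an arbitrary successful reduction, whatever the order in which it handles them. The
  par link raises the same question with the two halves of a split daimon. The pair predicate
  \<open>dual_types\<close> is what is carried through formulas: negation exchanges tensor and par,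
  and having the unary daimon on both sides fixes the arity to one and keeps all polars
  nonempty.\<close>

datatype 'p ulink =
    UTensor 'p 'p 'p
  | UPar 'p 'p 'p
  | UCut "'p multiset"
  | UDaimon "'p multiset"

text \<open>Forgetting these orders loses nothing for success: which steps are possible depends only
  on membership, and the final \<open>DaimonL []\<close> has no outputs to order.\<close>

fun unord :: "'p link \<Rightarrow> 'p ulink" where
  "unord (TensorL p1 p2 p) = UTensor p1 p2 p"
| "unord (ParL p1 p2 p) = UPar p1 p2 p"
| "unord (CutL p q) = UCut {#p, q#}"
| "unord (DaimonL ps) = UDaimon (mset ps)"

lemma unord_map_link: "unord (map_link f l) = map_ulink f (unord l)"
  by (cases l) auto

lemma set_ulink_unord: "set_ulink (unord l) = set (source l) \<union> set (target l)"
  by (cases l) auto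

lemma unord_eqD:
  "unord l = UTensor p1 p2 p \<Longrightarrow> l = TensorL p1 p2 p"
  "unord l = UPar p1 p2 p \<Longrightarrow> l = ParL p1 p2 p"
  "unord l = UCut {#p, q#} \<Longrightarrow> l \<in> {CutL p q, CutL q p}"
  "unord l = UDaimon M \<Longrightarrow> \<exists>ps. l = DaimonL ps \<and> mset ps = M"
  by (cases l; auto simp: add_eq_conv_ex)+

text \<open>
  The reducts of the last two rules are required for all positions, fresh or not. This is
  equivalent to one fresh choice, since collapsing is preserved by arbitrary, even non-injective,
  renamings, and it makes all bookkeeping about freshness and disjointness disappear.
\<close>

inductive collapses :: "nat ulink multiset \<Rightarrow> bool" where
  base: "collapses {#UDaimon {#}#}"
| par_tensor:
    "collapses (add_mset (UCut {#p1, q1#}) (add_mset (UCut {#p2, q2#}) H)) \<Longrightarrow>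
     collapses (add_mset (UPar p1 p2 p) (add_mset (UCut {#p, q#}) (add_mset (UTensor q1 q2 q) H)))"
| daimon_daimon:
    "collapses (add_mset (UDaimon (M + N)) H) \<Longrightarrow>
     collapses (add_mset (UDaimon (add_mset p M)) (add_mset (UCut {#p, q#})
       (add_mset (UDaimon (add_mset q N)) H)))"
| tensor_daimon:
    "(\<And>q1 q2. collapses (add_mset (UCut {#p1, q1#}) (add_mset (UCut {#p2, q2#})
       (add_mset (UDaimon (add_mset q1 (add_mset q2 M))) H)))) \<Longrightarrow>
     collapses (add_mset (UTensor p1 p2 p) (add_mset (UCut {#p, q#})
       (add_mset (UDaimon (add_mset q M)) H)))"
| par_daimon:
    "(\<And>p1 p2. collapses (add_mset (UCut {#q1, p1#}) (add_mset (UCut {#q2, p2#})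
       (add_mset (UDaimon (add_mset p1 M)) (add_mset (UDaimon (add_mset p2 N)) H))))) \<Longrightarrow>
     collapses (add_mset (UPar q1 q2 q) (add_mset (UCut {#q, p#})
       (add_mset (UDaimon (add_mset p (M + N))) H)))"

section \<open>Renaming of collapsing hypergraphs\<close>

definition upositions :: "nat ulink multiset \<Rightarrow> nat set" where
  "upositions H = (\<Union>l\<in>set_mset H. set_ulink l)"

lemma finite_set_ulink [simp]: "finite (set_ulink l)"
  by (cases l) auto

lemma finite_upositions [simp]: "finite (upositions H)"
  by (simp add: upositions_def)

lemma upositions_simps [simp]:
  "upositions {#} = {}" "upositions (add_mset l H) = set_ulink l \<union> upositions H"
      "upositions (H + K) = upositions H \<union> upositions K"
  by (auto simp: upositions_def)

lemma map_ulink_cong_mset: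
  "(\<And>x. x \<in> upositions H \<Longrightarrow> f x = g x) \<Longrightarrow> image_mset (map_ulink f) H = image_mset (map_ulink g) H"
  by (intro image_mset_cong ulink.map_cong0) (auto simp: upositions_def)

lemma obtain_two_fresh:
  assumes "finite (X :: nat set)"
  obtains a b where "a \<notin> X" "b \<notin> X" "a \<noteq> b"
  using assms ex_new_if_finite[of X] ex_new_if_finite[of "insert a X" for a]
  by (metis finite_insert infinite_UNIV_nat insertCI)

text \<open>For the last two rules the new positions \<open>r1\<close>, \<open>r2\<close> are
  arbitrary. The induction hypothesis is used at fresh positions and with \<open>f\<close> redefined
  only there, which leaves the images of all other links unchanged; hence \<open>f\<close> is
  general in the induction.\<close>

lemma collapses_map: "collapses H \<Longrightarrow> collapses (image_mset (map_ulink f) H)"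
proof (induction arbitrary: f rule: collapses.induct)
  case base
  show ?case by (simp add: collapses.base)
next
  case (par_tensor p1 q1 p2 q2 H p q)
  then show ?case using collapses.par_tensor by simp
next
  case (daimon_daimon M N H p q)
  then show ?case using collapses.daimon_daimon by simp
next
  case (tensor_daimon p1 p2 M H p q)
  have "collapses (add_mset (UCut {#f p1, r1#}) (add_mset (UCut {#f p2, r2#})
       (add_mset (UDaimon (add_mset r1 (add_mset r2 (image_mset f M)))) (image_mset
           (map_ulink f) H))))"
    for r1 r2
  proof -
    obtain q1 q2 where q: "q1 \<notin> {p1, p2} \<union> set_mset M \<union> upositions H"
        "q2 \<notin> {p1, p2} \<union> set_mset M \<union> upositions H" "q1 \<noteq> q2"
      by (rule obtain_two_fresh[of "{p1, p2} \<union> set_mset M \<union> upositions H"]) auto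
    let ?g = "f(q1 := r1, q2 := r2)"
    have "image_mset (map_ulink ?g) H = image_mset (map_ulink f) H"
      using q by (intro map_ulink_cong_mset) auto
    moreover have "image_mset ?g M = image_mset f M"
      using q by (intro image_mset_cong) auto
    ultimately show ?thesis
      using tensor_daimon.IH[where f = ?g and ?q1.0 = q1 and ?q2.0 = q2] q
          by (auto simp del: fun_upd_apply simp: fun_upd_other fun_upd_same)
  qed
  then show ?case using collapses.tensor_daimon by simp
next
  case (par_daimon q1 q2 M N H q p)
  have "collapses (add_mset (UCut {#f q1, r1#}) (add_mset (UCut {#f q2, r2#})
       (add_mset (UDaimon (add_mset r1 (image_mset f M))) (add_mset (UDaimon (add_mset r2
           (image_mset f N)))
         (image_mset (map_ulink f) H)))))"
    for r1 r2
  proof -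
    obtain p1 p2 where q: "p1 \<notin> {q1, q2} \<union> set_mset (M + N) \<union> upositions H"
        "p2 \<notin> {q1, q2} \<union> set_mset (M + N) \<union> upositions H" "p1 \<noteq> p2"
      by (rule obtain_two_fresh[of "{q1, q2} \<union> set_mset (M + N) \<union> upositions H"]) auto
    let ?g = "f(p1 := r1, p2 := r2)"
    have "image_mset (map_ulink ?g) H = image_mset (map_ulink f) H"
      using q by (intro map_ulink_cong_mset) auto
    moreover have "image_mset ?g M = image_mset f M" "image_mset ?g N = image_mset f N"
      using q by (intro image_mset_cong; auto)+
    ultimately show ?thesis
      using par_daimon.IH[where f = ?g and ?p1.0 = p1 and ?p2.0 = p2] q
          by (auto simp del: fun_upd_apply simp: fun_upd_other fun_upd_same)
  qed
  then show ?case using collapses.par_daimon by simp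
qed

text \<open>A fresh pair can be renamed to any pair while everything else is fixed, so one fresh
  instance yields the premise of \<open>collapses.tensor_daimon\<close> for all positions.\<close>

lemma collapses_tensor_daimon_fresh:
  assumes "collapses (add_mset (UCut {#p1, q1#}) (add_mset (UCut {#p2, q2#})
       (add_mset (UDaimon (add_mset q1 (add_mset q2 M))) H)))"
    and "q1 \<notin> {p1, p2} \<union> set_mset M \<union> upositions H" "q2 \<notin> {p1, p2} \<union> set_mset M \<union> upositions H"
        "q1 \<noteq> q2"
  shows "collapses (add_mset (UTensor p1 p2 p) (add_mset (UCut {#p, q#})
       (add_mset (UDaimon (add_mset q M)) H)))"
proof (rule collapses.tensor_daimon)
  fix r1 r2
  let ?g = "id(q1 := r1, q2 := r2)"
  have "image_mset (map_ulink ?g) H = image_mset (map_ulink id) H"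
    using assms by (intro map_ulink_cong_mset) auto
  moreover have "image_mset ?g M = image_mset id M"
    using assms by (intro image_mset_cong) auto
  ultimately show "collapses (add_mset (UCut {#p1, r1#}) (add_mset (UCut {#p2, r2#})
       (add_mset (UDaimon (add_mset r1 (add_mset r2 M))) H)))"
    using collapses_map[OF assms(1), of ?g] assms(2-)
        by (auto simp del: fun_upd_apply simp: fun_upd_other fun_upd_same ulink.map_id0)
qed

lemma collapses_par_daimon_fresh:
  assumes "collapses (add_mset (UCut {#q1, p1#}) (add_mset (UCut {#q2, p2#})
       (add_mset (UDaimon (add_mset p1 M)) (add_mset (UDaimon (add_mset p2 N)) H))))"
    and "p1 \<notin> {q1, q2} \<union> set_mset (M + N) \<union> upositions H"
        "p2 \<notin> {q1, q2} \<union> set_mset (M + N) \<union> upositions H"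
      "p1 \<noteq> p2"
  shows "collapses (add_mset (UPar q1 q2 q) (add_mset (UCut {#q, p#})
       (add_mset (UDaimon (add_mset p (M + N))) H)))"
proof (rule collapses.par_daimon)
  fix r1 r2
  let ?g = "id(p1 := r1, p2 := r2)"
  have "image_mset (map_ulink ?g) H = image_mset (map_ulink id) H"
    using assms by (intro map_ulink_cong_mset) auto
  moreover have "image_mset ?g M = image_mset id M" "image_mset ?g N = image_mset id N"
    using assms by (intro image_mset_cong; auto)+
  ultimately show "collapses (add_mset (UCut {#q1, r1#}) (add_mset (UCut {#q2, r2#})
       (add_mset (UDaimon (add_mset r1 M)) (add_mset (UDaimon (add_mset r2 N)) H))))"
    using collapses_map[OF assms(1), of ?g] assms(2-)
        by (auto simp del: fun_upd_apply simp: fun_upd_other fun_upd_same ulink.map_id0)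
qed

section \<open>Collapsing is reduction to the daimon without outputs\<close>

lemma upositions_unord: "upositions (image_mset unord L) = positions L"
  by (simp add: upositions_def positions_def set_ulink_unord)

lemma cut_step_collapses:
  assumes "cut_step L R" "collapses (image_mset unord R)"
  shows "collapses (image_mset unord L)"
  using assms(1)
proof cases
  case (par_tensor c p q H p1 p2 q1 q2)
  then have "unord c = UCut {#p, q#}" by auto
  then show ?thesis
    using par_tensor assms(2) collapses.par_tensor[of p1 q1 p2 q2 "image_mset unord H" p q] by simp
next
  case (daimon_daimon c p q H as bs cs ds)
  then have "unord c = UCut {#p, q#}" by auto
  then show ?thesis
    using daimon_daimon assms(2)
      collapses.daimon_daimon[of "mset (as @ bs)" "mset (cs @ ds)" "image_mset unord H" p q]
    by (simp add: ac_simps)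
next
  case (tensor_daimon c p q H p1 p2 as bs q1 q2)
  then have "unord c = UCut {#p, q#}" by auto
  then show ?thesis
    using tensor_daimon assms(2)
      collapses_tensor_daimon_fresh[of p1 q1 p2 q2 "mset (as @ bs)" "image_mset unord H" p q]
    by (auto simp: upositions_unord positions_def)
next
  case (par_daimon c q p H q1 q2 as bs p1 p2 as1 as2 bs1 bs2)
  then have "unord c = UCut {#q, p#}" by auto
  \<comment> \<open>Freshness of \<open>p1\<close>, \<open>p2\<close> is known for the old daimon;
    comparing output sets transfers it to the two new ones.\<close>
  moreover have "set as = set as1 \<union> set as2" "set bs = set bs1 \<union> set bs2"
    using par_daimon(7,8) by (metis set_mset_mset set_mset_union)+
  ultimately show ?thesis
    using par_daimon assms(2)
      collapses_par_daimon_fresh[of q1 p1 q2 p2 "mset (as1 @ bs1)" "mset (as2 @ bs2)"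
          "image_mset unord H" q p]
    by (auto simp: upositions_unord positions_def ac_simps)
qed

text \<open>The Riesz refinement property of multisets. Taking \<open>A \<inter># C\<close> for the
  common part of \<open>A\<close> and \<open>C\<close> forces the other three pieces by
  cancellation.\<close>

lemma mset_refinement:
  assumes "A + B = C + (D :: 'a multiset)"
  obtains A1 A2 B1 B2 where "A = A1 + A2" "B = B1 + B2" "C = A1 + B1" "D = A2 + B2"
proof
  have c: "count A x + count B x = count C x + count D x" for x
    using assms by (metis count_union)
  show "A = (A \<inter># C) + (A - C)" by (auto intro!: multiset_eqI)
  show "C = (A \<inter># C) + (C - A)" by (auto intro!: multiset_eqI)
  show "B = (C - A) + (D - (A - C))"
  proof (rule multiset_eqI)
    fix x show "count B x = count (C - A + (D - (A - C))) x"
      using c[of x] by simp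
  qed
  show "D = (A - C) + (D - (A - C))"
  proof (rule multiset_eqI)
    fix x show "count D x = count (A - C + (D - (A - C))) x"
      using c[of x] by simp
  qed
qed

lemma mset_eq_add_split:
  assumes "mset ps = add_mset p M"
  obtains as bs where "ps = as @ p # bs" "mset as + mset bs = M"
proof -
  have "p \<in> set ps" using assms by (metis set_mset_mset union_single_eq_member)
  then obtain as bs where "ps = as @ p # bs" by (meson split_list)
  with assms that show thesis by auto
qed

lemma finite_positions [simp]: "finite (positions H)"
  by (simp add: positions_def)

lemma image_mset_eq_add3E:
  assumes "image_mset f L = add_mset a (add_mset b (add_mset c H))"
  obtains x y z K where "L = K + {#x, y, z#}" "f x = a" "f y = b" "f z = c" "image_mset f K = H"
proof -
  obtain x L1 where 1: "L = add_mset x L1" "f x = a" "image_mset f L1 = add_mset b (add_mset c H)"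
    using msed_map_invR[OF assms] by auto
  obtain y L2 where 2: "L1 = add_mset y L2" "f y = b" "image_mset f L2 = add_mset c H"
    using msed_map_invR[OF 1(3)] by auto
  obtain z K where 3: "L2 = add_mset z K" "f z = c" "image_mset f K = H"
    using msed_map_invR[OF 2(3)] by auto
  show thesis
    using that[of K x y z] 1 2 3 by simp
qed

text \<open>The claim is made for every ordered presentation \<open>L\<close>, since the unordered
  rules do not control how outputs end up arranged. Where a step creates positions, the hypothesis
  is used at positions fresh for \<open>L\<close>.\<close>

lemma collapses_cut_steps:
  "collapses M \<Longrightarrow> image_mset unord L = M \<Longrightarrow> cut_step\<^sup>*\<^sup>* L {#DaimonL []#}"
proof (induction arbitrary: L rule: collapses.induct)
  case base
  then obtain l where "L = {#l#}" "unord l = UDaimon {#}"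
    by (auto dest: msed_map_invR)
  then show ?case by (cases l) auto
next
  case (par_tensor p1 q1 p2 q2 H p q)
  obtain x c z K where "L = K + {#x, c, z#}" "unord x = UPar p1 p2 p" "unord c = UCut {#p, q#}"
    "unord z = UTensor q1 q2 q" "image_mset unord K = H"
    using par_tensor.prems by (rule image_mset_eq_add3E)
  then have L: "L = K + {#ParL p1 p2 p, c, TensorL q1 q2 q#}" "unord c = UCut {#p, q#}"
    "image_mset unord K = H"
    by (auto dest!: unord_eqD(1,2))
  then have "cut_step L (K + {#CutL p1 q1, CutL p2 q2#})"
    using cut_step.par_tensor[OF unord_eqD(3)[OF L(2)]] by auto
  moreover have "cut_step\<^sup>*\<^sup>* (K + {#CutL p1 q1, CutL p2 q2#}) {#DaimonL []#}"
    by (rule par_tensor.IH) (simp add: L)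
  ultimately show ?case by (rule converse_rtranclp_into_rtranclp)
next
  case (daimon_daimon M N H p q)
  obtain x c z K where "L = K + {#x, c, z#}" "unord x = UDaimon (add_mset p M)"
    "unord c = UCut {#p, q#}" "unord z = UDaimon (add_mset q N)" "image_mset unord K = H"
    using daimon_daimon.prems by (rule image_mset_eq_add3E)
  then obtain ps qs where L: "L = K + {#DaimonL ps, c, DaimonL qs#}" "unord c = UCut {#p, q#}"
    "mset ps = add_mset p M" "mset qs = add_mset q N" "image_mset unord K = H"
    by (auto dest!: unord_eqD(4))
  obtain as bs cs ds where ps: "ps = as @ p # bs" "mset as + mset bs = M"
    "qs = cs @ q # ds" "mset cs + mset ds = N"
    using mset_eq_add_split[OF L(3)] mset_eq_add_split[OF L(4)] by metis
  then have "cut_step L (K + {#DaimonL (as @ bs @ cs @ ds)#})"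
    using cut_step.daimon_daimon[OF unord_eqD(3)[OF L(2)]] L(1) by auto
  moreover have "cut_step\<^sup>*\<^sup>* (K + {#DaimonL (as @ bs @ cs @ ds)#}) {#DaimonL []#}"
    by (rule daimon_daimon.IH) (auto simp: L ps(2,4)[symmetric] ac_simps)
  ultimately show ?case by (rule converse_rtranclp_into_rtranclp)
next
  case (tensor_daimon p1 p2 M H p q)
  obtain x c z K where "L = K + {#x, c, z#}" "unord x = UTensor p1 p2 p"
    "unord c = UCut {#p, q#}" "unord z = UDaimon (add_mset q M)" "image_mset unord K = H"
    using tensor_daimon.prems by (rule image_mset_eq_add3E)
  then obtain qs where L: "L = K + {#TensorL p1 p2 p, c, DaimonL qs#}" "unord c = UCut {#p, q#}"
    "mset qs = add_mset q M" "image_mset unord K = H"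
    by (auto dest!: unord_eqD(1,4))
  obtain as bs where qs: "qs = as @ q # bs" "mset as + mset bs = M"
    using L(3) by (rule mset_eq_add_split)
  obtain q1 q2 where fr: "q1 \<notin> positions L" "q2 \<notin> positions L" "q1 \<noteq> q2"
    by (rule obtain_two_fresh[of "positions L"]) auto
  have "cut_step L (K + {#CutL p1 q1, CutL p2 q2, DaimonL (as @ [q1, q2] @ bs)#})"
    by (rule cut_step.tensor_daimon[OF unord_eqD(3)[OF L(2)] _ fr]) (simp add: L(1) qs)
  moreover have "cut_step\<^sup>*\<^sup>* (K + {#CutL p1 q1, CutL p2 q2, DaimonL (as @ [q1, q2] @ bs)#})
      {#DaimonL []#}"
    by (rule tensor_daimon.IH[where ?q1.0 = q1 and ?q2.0
        = q2]) (auto simp: L qs(2)[symmetric] ac_simps)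
  ultimately show ?case by (rule converse_rtranclp_into_rtranclp)
next
  case (par_daimon q1 q2 M N H q p)
  obtain x c z K where "L = K + {#x, c, z#}" "unord x = UPar q1 q2 q"
    "unord c = UCut {#q, p#}" "unord z = UDaimon (add_mset p (M + N))" "image_mset unord K = H"
    using par_daimon.prems by (rule image_mset_eq_add3E)
  then obtain ps where L: "L = K + {#ParL q1 q2 q, c, DaimonL ps#}" "unord c = UCut {#q, p#}"
    "mset ps = add_mset p (M + N)" "image_mset unord K = H"
    by (auto dest!: unord_eqD(2,4))
  obtain as bs where ps: "ps = as @ p # bs" "mset as + mset bs = M + N"
    using L(3) by (rule mset_eq_add_split)
  \<comment> \<open>\<open>M\<close> and \<open>N\<close> split the remaining outputs as a whole,
    whereas \<open>cut_step\<close> splits those before and those after \<open>p\<close> separately;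
    refinement gives the four pieces.\<close>
  obtain A1 A2 B1 B2 where "mset as = A1 + A2" "mset bs = B1 + B2" "M = A1 + B1" "N = A2 + B2"
    using ps(2) by (rule mset_refinement)
  moreover obtain as1 as2 bs1 bs2 where "mset as1 = A1" "mset as2 = A2" "mset bs1 = B1"
      "mset bs2 = B2"
    using ex_mset by metis
  ultimately have sp: "mset as = mset as1 + mset as2" "mset bs = mset bs1 + mset bs2"
    "M = mset as1 + mset bs1" "N = mset as2 + mset bs2"
    by simp_all
  obtain p1 p2 where fr: "p1 \<notin> positions L" "p2 \<notin> positions L" "p1 \<noteq> p2"
    by (rule obtain_two_fresh[of "positions L"]) auto
  have "cut_step L (K + {#CutL q1 p1, CutL q2 p2, DaimonL (as1 @ p1 # bs1), DaimonL
      (as2 @ p2 # bs2)#})"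
    by (rule cut_step.par_daimon[OF unord_eqD(3)[OF L(2)] _ fr sp(1,2)]) (simp add: L(1) ps)
  moreover have "cut_step\<^sup>*\<^sup>* (K + {#CutL q1 p1, CutL q2 p2, DaimonL (as1 @ p1 # bs1), DaimonL
      (as2 @ p2 # bs2)#})
      {#DaimonL []#}"
    by (rule par_daimon.IH[where ?p1.0 = p1 and ?p2.0 = p2]) (auto simp: L sp ac_simps)
  ultimately show ?case by (rule converse_rtranclp_into_rtranclp)
qed

lemma collapses_iff_cut_steps: "collapses (image_mset unord L) \<longleftrightarrow> cut_step\<^sup>*\<^sup>* L {#DaimonL []#}"
proof
  show "collapses (image_mset unord L)" if "cut_step\<^sup>*\<^sup>* L {#DaimonL []#}"
    using that
  proof (induction rule: converse_rtranclp_induct)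
    case base
    show ?case by (simp add: collapses.base)
  qed (rule cut_step_collapses)
qed (simp add: collapses_cut_steps)

section \<open>Simulations\<close>

text \<open>This locates a redex: \<open>E\<close> is consumed by a step, \<open>F\<close> consists
  of the links under study, and both sit in the same hypergraph. Sharing no link, \<open>E\<close>
  lies in the context of \<open>F\<close>, and \<open>K\<close> is what is outside both.\<close>

lemma mset_disjoint_split:
  assumes "E + H0 = F + (H :: 'a multiset)" "\<And>x. x \<in># E \<Longrightarrow> x \<notin># F"
  obtains K where "H = E + K" "H0 = F + K"
proof -
  obtain A1 A2 B1 B2 where "E = A1 + A2" "H0 = B1 + B2" "F = A1 + B1" "H = A2 + B2"
    using assms(1) by (rule mset_refinement)
  moreover from this have "A1 = {#}"
    using assms(2) by (metis multiset_nonemptyE union_iff)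
  ultimately show thesis using that by simp
qed

text \<open>The reduction of \<open>L\<close> is replayed with the outputs \<open>N\<close> riding
  along on the distinguished daimon. It ends with that daimon reduced to \<open>N\<close>, beside
  \<open>K\<close>, where the second reduction takes over.\<close>

lemma collapses_merge:
  "collapses L \<Longrightarrow> L = add_mset (UDaimon M) H \<Longrightarrow> collapses (add_mset (UDaimon N) K) \<Longrightarrow>
   collapses (add_mset (UDaimon (M + N)) (H + K))"
proof (induction arbitrary: M H rule: collapses.induct)
  case base
  then show ?case by simp
next
  case (par_tensor p1 q1 p2 q2 H0 p q)
  from par_tensor.prems(1) obtain H' where
    "H0 = add_mset (UDaimon M) H'"
    "H = add_mset (UPar p1 p2 p) (add_mset (UCut {#p, q#}) (add_mset (UTensor q1 q2 q) H'))"
    by (auto simp: add_eq_conv_ex)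
  then show ?case
    using par_tensor.IH[of M "add_mset (UCut {#p1, q1#}) (add_mset
        (UCut {#p2, q2#}) H')"] par_tensor.prems(2)
      collapses.par_tensor[of p1 q1 p2 q2 "add_mset (UDaimon (M + N)) (H' + K)" p q]
    by (simp add: add_mset_commute)
next
  case (daimon_daimon M0 N0 H0 p q)
  from daimon_daimon.prems(1) consider
      "M = add_mset p M0" "H = add_mset (UCut {#p, q#}) (add_mset (UDaimon (add_mset q N0)) H0)"
    | "M = add_mset q N0" "H = add_mset (UCut {#p, q#}) (add_mset (UDaimon (add_mset p M0)) H0)"
    | H' where "H0 = add_mset (UDaimon M) H'" "H
        = add_mset (UDaimon (add_mset p M0)) (add_mset (UCut {#p, q#}) (add_mset (UDaimon
        (add_mset q N0)) H'))"
    by (auto simp: add_eq_conv_ex)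
  then show ?case
  proof cases
    case 1
    then show ?thesis
      using daimon_daimon.IH[of "M0 + N0" H0] daimon_daimon.prems(2)
        collapses.daimon_daimon[of "M0 + N" N0 "H0 + K" p q]
      by (simp add: ac_simps)
  next
    case 2
    then show ?thesis
      using daimon_daimon.IH[of "M0 + N0" H0] daimon_daimon.prems(2)
        collapses.daimon_daimon[of "M0" "N0 + N" "H0 + K" p q]
      by (simp add: ac_simps add_mset_commute)
  next
    case (3 H')
    then show ?thesis
      using daimon_daimon.IH[of M "add_mset (UDaimon (M0 + N0)) H'"] daimon_daimon.prems(2)
        collapses.daimon_daimon[of "M0" "N0" "add_mset (UDaimon (M + N)) (H' + K)" p q]
      by (simp add: add_mset_commute)
  qed
next
  case (tensor_daimon p1 p2 M0 H0 p q)
  from tensor_daimon.prems(1) consider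
      "M = add_mset q M0" "H = add_mset (UTensor p1 p2 p) (add_mset (UCut {#p, q#}) H0)"
    | H' where "H0 = add_mset (UDaimon M) H'"
      "H = add_mset (UTensor p1 p2 p) (add_mset (UCut {#p, q#}) (add_mset (UDaimon
          (add_mset q M0)) H'))"
    by (auto simp: add_eq_conv_ex)
  then show ?case
  proof cases
    case 1
    have "collapses (add_mset (UCut {#p1, q1#}) (add_mset (UCut {#p2, q2#})
       (add_mset (UDaimon (add_mset q1 (add_mset q2 (M0 + N)))) (H0 + K))))" for q1 q2
      using tensor_daimon.IH[of q1 q2 "add_mset q1 (add_mset q2 M0)"
          "add_mset (UCut {#p1, q1#}) (add_mset (UCut {#p2, q2#}) H0)"]
        tensor_daimon.prems(2)
      by (simp add: add_mset_commute)
    from collapses.tensor_daimon[OF this, of p q] 1 show ?thesis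
      by (simp add: add_mset_commute)
  next
    case (2 H')
    have "collapses (add_mset (UCut {#p1, q1#}) (add_mset (UCut {#p2, q2#})
       (add_mset (UDaimon (add_mset q1 (add_mset q2 M0))) (add_mset (UDaimon (M + N)) (H' + K)))))"
           for q1 q2
      using tensor_daimon.IH[of q1 q2 M "add_mset (UDaimon (add_mset q1 (add_mset q2 M0))) (add_mset
          (UCut {#p1, q1#}) (add_mset (UCut {#p2, q2#}) H'))"]
        tensor_daimon.prems(2) 2
      by (simp add: add_mset_commute)
    from collapses.tensor_daimon[OF this, of p q] 2 show ?thesis
      by (simp add: add_mset_commute)
  qed
next
  case (par_daimon q1 q2 M0 N0 H0 q p)
  from par_daimon.prems(1) consider
      "M = add_mset p (M0 + N0)" "H = add_mset (UPar q1 q2 q) (add_mset (UCut {#q, p#}) H0)"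
    | H' where "H0 = add_mset (UDaimon M) H'"
      "H = add_mset (UPar q1 q2 q) (add_mset (UCut {#q, p#}) (add_mset (UDaimon (add_mset p
          (M0 + N0))) H'))"
    by (auto simp: add_eq_conv_ex)
  then show ?case
  proof cases
    case 1
    \<comment> \<open>The distinguished daimon is itself split; the choice of halves is free, and
      \<open>N\<close> goes to the half of \<open>p1\<close>.\<close>
    have "collapses (add_mset (UCut {#q1, p1#}) (add_mset (UCut {#q2, p2#})
       (add_mset (UDaimon (add_mset p1 (M0 + N))) (add_mset (UDaimon (add_mset p2 N0)) (H0 + K)))))"
           for p1 p2
      using par_daimon.IH[of p1 p2 "add_mset p1 M0"
          "add_mset (UDaimon (add_mset p2 N0)) (add_mset (UCut {#q1, p1#}) (add_mset
          (UCut {#q2, p2#}) H0))"]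
        par_daimon.prems(2)
      by (simp add: add_mset_commute)
    from collapses.par_daimon[OF this, of q p] 1 show ?thesis
      by (simp add: add_mset_commute ac_simps)
  next
    case (2 H')
    have "collapses (add_mset (UCut {#q1, p1#}) (add_mset (UCut {#q2, p2#})
       (add_mset (UDaimon (add_mset p1 M0)) (add_mset (UDaimon (add_mset p2 N0)) (add_mset (UDaimon
           (M + N)) (H' + K))))))" for p1 p2
      using par_daimon.IH[of p1 p2 M "add_mset (UDaimon (add_mset p1 M0)) (add_mset (UDaimon
          (add_mset p2 N0)) (add_mset (UCut {#q1, p1#}) (add_mset (UCut {#q2, p2#}) H')))"]
        par_daimon.prems(2) 2
      by (simp add: add_mset_commute)
    from collapses.par_daimon[OF this, of q p] 2 show ?thesis
      by (simp add: add_mset_commute)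
  qed
qed

text \<open>
  The delicate point of the simulation below is a second cut \<open>r, s\<close> between the same two daimons:
  reducing it leaves a daimon cut with itself through \<open>p, q\<close>, whereas contracting the cut \<open>p, q\<close>
  leaves a daimon cut with itself through \<open>r, s\<close>. The renaming of \<open>p, q\<close> to \<open>r, s\<close> maps
  the former to the latter.
\<close>

definition contractible :: "nat ulink multiset \<Rightarrow> bool" where
  "contractible L \<longleftrightarrow> (\<forall>p q M N H.
     L = add_mset (UDaimon (add_mset p M)) (add_mset (UCut {#p, q#}) (add_mset (UDaimon
         (add_mset q N)) H)) \<longrightarrow>
     p \<noteq> q \<longrightarrow> {p, q} \<inter> (set_mset M \<union> set_mset N \<union> upositions H) = {} \<longrightarrow>
     collapses (add_mset (UDaimon (M + N)) H))"

section \<open>Contracting a cut between two daimons\<close>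

lemma contractibleD:
  assumes "contractible L"
    and "L = add_mset (UDaimon (add_mset p M)) (add_mset (UCut {#p, q#}) (add_mset (UDaimon
        (add_mset q N)) H))"
    and "p \<noteq> q" "{p, q} \<inter> (set_mset M \<union> set_mset N \<union> upositions H) = {}"
  shows "collapses (add_mset (UDaimon (M + N)) H)"
  using assms unfolding contractible_def by blast

text \<open>The first daimon of the step is the one carrying \<open>p\<close>. If the second one
  carries \<open>q\<close>, the renaming argument is applied to \<open>prem\<close>; otherwise the
  step and the contraction commute, by \<open>IH\<close>.\<close>

lemma contract_daimon_daimon:
  assumes IH: "contractible (add_mset (UDaimon (X + Y)) H0)"
    and prem: "collapses (add_mset (UDaimon (X + Y)) H0)"
    and eq: "add_mset (UDaimon (add_mset r X)) (add_mset (UCut {#r, s#}) (add_mset (UDaimon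
        (add_mset s Y)) H0)) =
      add_mset (UDaimon (add_mset p M)) (add_mset (UCut {#p, q#}) (add_mset (UDaimon
          (add_mset q N)) H))"
    and pq: "p \<noteq> q" "{p, q} \<inter> (set_mset M \<union> set_mset N \<union> upositions H) = {}"
    and rs: "r \<notin> {p, q}" "s \<notin> {p, q}"
    and M: "add_mset r X = add_mset p M"
  shows "collapses (add_mset (UDaimon (M + N)) H)"
proof -
  from M rs(1) obtain Z where Z: "X = add_mset p Z" "M = add_mset r Z"
    by (auto simp: add_eq_conv_ex)
  from eq M have eq1: "add_mset (UCut {#r, s#}) (add_mset (UDaimon (add_mset s Y)) H0) =
      add_mset (UCut {#p, q#}) (add_mset (UDaimon (add_mset q N)) H)"
    by simp
  have cut: "UCut {#r, s#} \<noteq> UCut {#p, q#}" using rs by (auto simp: add_eq_conv_ex)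
  show ?thesis
  proof (cases "add_mset s Y = add_mset q N")
    case True
    with rs(2) obtain W where W: "Y = add_mset q W" "N = add_mset s W"
      by (auto simp: add_eq_conv_ex)
    from eq1 True have "add_mset (UCut {#r, s#}) H0 = add_mset (UCut {#p, q#}) H"
      by (simp add: add_mset_commute)
    with cut obtain K where K: "H = add_mset (UCut {#r, s#}) K" "H0 = add_mset (UCut {#p, q#}) K"
      by (auto simp: add_eq_conv_ex)
    let ?f = "id(p := r, q := s)"
    have "image_mset (map_ulink ?f) K = image_mset (map_ulink id) K"
      using pq K by (intro map_ulink_cong_mset) auto
    moreover have "image_mset ?f Z = image_mset id Z" "image_mset ?f W = image_mset id W"
      using pq Z W by (intro image_mset_cong; auto)+
    ultimately show ?thesis
      using collapses_map[OF prem, of ?f] pq(1)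
      by (simp add: K Z W ulink.map_id0 add_mset_commute)
  next
    case False
    obtain K where K: "H = {#UCut {#r, s#}, UDaimon (add_mset s Y)#} + K"
      "H0 = {#UCut {#p, q#}, UDaimon (add_mset q N)#} + K"
      by (rule mset_disjoint_split[of "{#UCut {#r, s#}, UDaimon (add_mset s Y)#}" H0
          "{#UCut {#p, q#}, UDaimon (add_mset q N)#}" H]) (use eq1 cut False in auto)
    have "collapses (add_mset (UDaimon ((Z + Y) + N)) K)"
      by (rule contractibleD[OF IH _ pq(1)]) (use pq in \<open>auto simp: K Z add_mset_commute\<close>)
    then show ?thesis
      using collapses.daimon_daimon[of "Z + N" Y K r s] by (simp add: K Z ac_simps add_mset_commute)
  qed
qed

text \<open>The daimon that gets expanded is the one carrying \<open>p\<close>. It still carries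
  \<open>p\<close> afterwards, so the contraction commutes with the step once the new positions are
  chosen away from \<open>p\<close> and \<open>q\<close>.\<close>

lemma contract_tensor_daimon:
  assumes IH: "\<And>q1 q2. contractible (add_mset (UCut {#p1, q1#}) (add_mset (UCut {#p2, q2#})
       (add_mset (UDaimon (add_mset q1 (add_mset q2 Y))) H0)))"
    and eq: "add_mset (UTensor p1 p2 r) (add_mset (UCut {#r, s#}) (add_mset (UDaimon
        (add_mset s Y)) H0)) =
      add_mset (UDaimon (add_mset p M)) (add_mset (UCut {#p, q#}) (add_mset (UDaimon
          (add_mset q N)) H))"
    and pq: "p \<noteq> q" "{p, q} \<inter> (set_mset M \<union> set_mset N \<union> upositions H) = {}"
    and rs: "r \<notin> {p, q}" "s \<notin> {p, q}"
    and M: "add_mset s Y = add_mset p M"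
  shows "collapses (add_mset (UDaimon (M + N)) H)"
proof -
  from M rs(2) obtain Z where Z: "Y = add_mset p Z" "M = add_mset s Z"
    by (auto simp: add_eq_conv_ex)
  from eq M have eq1: "{#UTensor p1 p2 r, UCut {#r, s#}#} + H0 =
      {#UCut {#p, q#}, UDaimon (add_mset q N)#} + H"
    by (simp add: add_mset_commute)
  have cut: "UCut {#r, s#} \<noteq> UCut {#p, q#}" using rs by (auto simp: add_eq_conv_ex)
  obtain K where K: "H = {#UTensor p1 p2 r, UCut {#r, s#}#} + K"
      "H0 = {#UCut {#p, q#}, UDaimon (add_mset q N)#} + K"
    by (rule mset_disjoint_split[OF eq1]) (use cut in auto)
  let ?X = "{p, q, p1, p2} \<union> set_mset Z \<union> set_mset N \<union> upositions K"
  obtain q1 q2 where f: "q1 \<notin> ?X" "q2 \<notin> ?X" "q1 \<noteq> q2"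
    by (rule obtain_two_fresh[of ?X]) auto
  let ?K = "add_mset (UCut {#p1, q1#}) (add_mset (UCut {#p2, q2#}) K)"
  have "collapses (add_mset (UDaimon ((add_mset q1 (add_mset q2 Z)) + N)) ?K)"
    by (rule contractibleD[OF IH[of q1 q2] _ pq(1)]) (use pq f in \<open>auto simp: K Z add_mset_commute\<close>)
  then show ?thesis
    using collapses_tensor_daimon_fresh[of p1 q1 p2 q2 "Z + N" K r s] f
    by (simp add: K Z add_mset_commute)
qed

text \<open>Splitting the daimon that carries \<open>p\<close> sends \<open>p\<close> into one half.
  If the contraction is done first, the split to choose is the one in which the outputs
  \<open>N\<close> follow \<open>p\<close> into that half.\<close>

lemma contract_par_daimon:
  assumes IH: "\<And>p1 p2. contractible (add_mset (UCut {#q1, p1#}) (add_mset (UCut {#q2, p2#})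
       (add_mset (UDaimon (add_mset p1 X)) (add_mset (UDaimon (add_mset p2 Y)) H0))))"
    and eq: "add_mset (UPar q1 q2 r) (add_mset (UCut {#r, s#}) (add_mset (UDaimon (add_mset s
        (X + Y))) H0)) =
      add_mset (UDaimon (add_mset p M)) (add_mset (UCut {#p, q#}) (add_mset (UDaimon
          (add_mset q N)) H))"
    and pq: "p \<noteq> q" "{p, q} \<inter> (set_mset M \<union> set_mset N \<union> upositions H) = {}"
    and rs: "r \<notin> {p, q}" "s \<notin> {p, q}"
    and M: "add_mset s (X + Y) = add_mset p M"
  shows "collapses (add_mset (UDaimon (M + N)) H)"
proof -
  from eq M have eq1: "{#UPar q1 q2 r, UCut {#r, s#}#} + H0 =
      {#UCut {#p, q#}, UDaimon (add_mset q N)#} + H"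
    by (simp add: add_mset_commute)
  have cut: "UCut {#r, s#} \<noteq> UCut {#p, q#}" using rs by (auto simp: add_eq_conv_ex)
  obtain K where K: "H = {#UPar q1 q2 r, UCut {#r, s#}#} + K"
      "H0 = {#UCut {#p, q#}, UDaimon (add_mset q N)#} + K"
    by (rule mset_disjoint_split[OF eq1]) (use cut in auto)
  let ?X = "{p, q, q1, q2} \<union> set_mset X \<union> set_mset Y \<union> set_mset M \<union> set_mset N \<union> upositions K"
  obtain p1 p2 where f: "p1 \<notin> ?X" "p2 \<notin> ?X" "p1 \<noteq> p2"
    by (rule obtain_two_fresh[of ?X]) auto
  have "p \<in># add_mset s (X + Y)" unfolding M by simp
  with rs consider "p \<in># X" | "p \<in># Y" by auto
  then show ?thesis
  proof cases
    case 1
    then obtain Z where Z: "X = add_mset p Z" by (meson multi_member_split)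
    with M have M': "M = add_mset s (Z + Y)" by (simp add: add_mset_commute)
    let ?K = "add_mset (UCut {#q1, p1#}) (add_mset (UCut {#q2, p2#}) (add_mset (UDaimon
        (add_mset p2 Y)) K))"
    have "collapses (add_mset (UDaimon (add_mset p1 Z + N)) ?K)"
      by (rule contractibleD[OF IH[of p1 p2] _ pq(1)])
          (use pq f in \<open>auto simp: K Z M' add_mset_commute\<close>)
    then show ?thesis
      using collapses_par_daimon_fresh[of q1 p1 q2 p2 "Z + N" Y K r s] f
      by (simp add: K Z M' add_mset_commute ac_simps)
  next
    case 2
    then obtain Z where Z: "Y = add_mset p Z" by (meson multi_member_split)
    with M have M': "M = add_mset s (X + Z)" by (simp add: add_mset_commute)
    let ?K = "add_mset (UCut {#q1, p1#}) (add_mset (UCut {#q2, p2#}) (add_mset (UDaimon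
        (add_mset p1 X)) K))"
    have "collapses (add_mset (UDaimon (add_mset p2 Z + N)) ?K)"
      by (rule contractibleD[OF IH[of p1 p2] _ pq(1)])
          (use pq f in \<open>auto simp: K Z M' add_mset_commute\<close>)
    then show ?thesis
      using collapses_par_daimon_fresh[of q1 p1 q2 p2 X "Z + N" K r s] f
      by (simp add: K Z M' add_mset_commute ac_simps)
  qed
qed

text \<open>The first step either is the contraction itself or has a cut avoiding \<open>p\<close>
  and \<open>q\<close>. In the latter case it is redone after the contraction, and only the question
  which of the two daimons it touches matters; two cuts between the same daimons are the exception
  settled by renaming.\<close>

lemma collapses_contractible: "collapses L \<Longrightarrow> contractible L"
proof (induction rule: collapses.induct)
  case base
  show ?case by (simp add: contractible_def)
next
  case (par_tensor p1 q1 p2 q2 H0 r s)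
  show ?case
    unfolding contractible_def
  proof (intro allI impI)
    fix p q M N H
    assume eq: "add_mset (UPar p1 p2 r) (add_mset (UCut {#r, s#}) (add_mset (UTensor q1 q2 s) H0)) =
      add_mset (UDaimon (add_mset p M)) (add_mset (UCut {#p, q#}) (add_mset (UDaimon
          (add_mset q N)) H))"
      and pq: "p \<noteq> q" "{p, q} \<inter> (set_mset M \<union> set_mset N \<union> upositions H) = {}"
    have "UPar p1 p2 r \<in># add_mset (UDaimon (add_mset p M)) (add_mset (UCut {#p, q#}) (add_mset
        (UDaimon (add_mset q N)) H))"
      unfolding eq[symmetric] by simp
    then have "r \<notin> {p, q}" using pq by (auto simp: upositions_def)
    then have cut: "UCut {#r, s#} \<noteq> UCut {#p, q#}" by (auto simp: add_eq_conv_ex)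
    obtain K where K: "H = {#UPar p1 p2 r, UCut {#r, s#}, UTensor q1 q2 s#} + K"
      "H0 = {#UDaimon (add_mset p M), UCut {#p, q#}, UDaimon (add_mset q N)#} + K"
      by (rule mset_disjoint_split[of "{#UPar p1 p2 r, UCut {#r, s#}, UTensor q1 q2 s#}" H0
          "{#UDaimon (add_mset p M), UCut {#p, q#}, UDaimon (add_mset q N)#}" H])
              (use eq cut in auto)
    have "collapses (add_mset (UDaimon (M + N)) (add_mset (UCut {#p1, q1#}) (add_mset
        (UCut {#p2, q2#}) K)))"
      by (rule contractibleD[OF par_tensor.IH _ pq(1)]) (use pq in \<open>auto simp: K add_mset_commute\<close>)
    then show "collapses (add_mset (UDaimon (M + N)) H)"
      using collapses.par_tensor[of p1 q1 p2 q2 "add_mset (UDaimon (M + N)) K" r s]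
      by (simp add: K add_mset_commute)
  qed
next
  case (daimon_daimon X Y H0 r s)
  show ?case
    unfolding contractible_def
  proof (intro allI impI)
    fix p q M N H
    assume eq: "add_mset (UDaimon (add_mset r X)) (add_mset (UCut {#r, s#}) (add_mset (UDaimon
        (add_mset s Y)) H0)) =
      add_mset (UDaimon (add_mset p M)) (add_mset (UCut {#p, q#}) (add_mset (UDaimon
          (add_mset q N)) H))"
      and pq: "p \<noteq> q" "{p, q} \<inter> (set_mset M \<union> set_mset N \<union> upositions H) = {}"
    show "collapses (add_mset (UDaimon (M + N)) H)"
    proof (cases "UCut {#r, s#} = UCut {#p, q#}")
      case True
      then have rs: "r = p \<and> s = q \<or> r = q \<and> s = p" by (auto simp: add_eq_conv_ex)
      have eq2: "add_mset (UDaimon (add_mset r X)) (add_mset (UDaimon (add_mset s Y)) H0) =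
        add_mset (UDaimon (add_mset p M)) (add_mset (UDaimon (add_mset q N)) H)"
        using eq unfolding True by (simp add: add_mset_commute)
      \<comment> \<open>\<open>p\<close> and \<open>q\<close> occur in the displayed links only, so
        a step on their cut can have consumed no other daimons.\<close>
      have nH: "UDaimon Z \<notin># H" if "p \<in># Z \<or> q \<in># Z" for Z
        using pq(2) that by (auto simp: upositions_def)
      have key: "X' = M \<and> Y' = N \<and> H0 = H"
        if e: "add_mset (UDaimon (add_mset p X')) (add_mset (UDaimon (add_mset q Y')) H0) =
          add_mset (UDaimon (add_mset p M)) (add_mset (UDaimon (add_mset q N)) H)" for X' Y'
      proof -
        have "UDaimon (add_mset p X') \<in># add_mset (UDaimon (add_mset p M)) (add_mset (UDaimon
            (add_mset q N)) H)"
          unfolding e[symmetric] by simp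
        moreover have "add_mset p X' \<noteq> add_mset q N"
          using pq by (metis IntI UnI1 UnI2 empty_iff insertI1 set_mset_add_mset_insert insertE)
        ultimately have X: "X' = M"
          using nH[of "add_mset p X'"] by auto
        with e have e': "add_mset (UDaimon (add_mset q Y')) H0
            = add_mset (UDaimon (add_mset q N)) H"
          by simp
        have "UDaimon (add_mset q Y') \<in># add_mset (UDaimon (add_mset q N)) H"
          unfolding e'[symmetric] by simp
        then have "Y' = N"
          using nH[of "add_mset q Y'"] by auto
        with X e' show ?thesis by simp
      qed
      \<comment> \<open>An unordered cut does not tell its ends apart, so both orientations have to
        be considered.\<close>
      have "X + Y = M + N \<and> H0 = H"
        using rs
      proof
        assume "r = p \<and> s = q"
        with key[of X Y] eq2 show ?thesis by simp
      next
        assume "r = q \<and> s = p"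
        with key[of Y X] eq2 show ?thesis by (simp add: add_mset_commute ac_simps)
      qed
      with daimon_daimon.hyps show ?thesis by simp
    next
      case False
      have "UCut {#r, s#} \<in># add_mset (UDaimon (add_mset p M)) (add_mset (UCut {#p, q#}) (add_mset
          (UDaimon (add_mset q N)) H))"
        unfolding eq[symmetric] by simp
      then have rs: "r \<notin> {p, q}" "s \<notin> {p, q}" using False pq by (auto simp: upositions_def)
      consider "add_mset r X = add_mset p M" | "add_mset r X = add_mset q N"
        | "add_mset s Y = add_mset p M" | "add_mset s Y = add_mset q N"
        | "add_mset r X \<noteq> add_mset p M" "add_mset r X \<noteq> add_mset q N" "add_mset s Y \<noteq> add_mset p M"
          "add_mset s Y \<noteq> add_mset q N"
        by blast
      then show ?thesis
      proof cases
        case 1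
        show ?thesis
          by (rule contract_daimon_daimon[OF daimon_daimon.IH daimon_daimon.hyps eq pq rs 1])
      next
        \<comment> \<open>Cases 2 to 4 are case 1 with the ends \<open>p\<close>, \<open>q\<close>
          exchanged, the ends \<open>r\<close>, \<open>s\<close> exchanged, or both.\<close>
        case 2
        have "collapses (add_mset (UDaimon (N + M)) H)"
          by (rule contract_daimon_daimon[OF daimon_daimon.IH daimon_daimon.hyps _ _ _ _ _ 2, of s
              p])
            (use eq pq rs in \<open>auto simp: add_mset_commute\<close>)
        then show ?thesis by (simp add: ac_simps)
      next
        case 3
        show ?thesis
          by (rule contract_daimon_daimon[of Y X H0 s r p M q N])
            (use 3 eq pq rs daimon_daimon in \<open>auto simp: add_mset_commute ac_simps\<close>)
      next
        case 4
        have "collapses (add_mset (UDaimon (N + M)) H)"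
          by (rule contract_daimon_daimon[of Y X H0 s r q N p M])
            (use 4 eq pq rs daimon_daimon in \<open>auto simp: add_mset_commute ac_simps\<close>)
        then show ?thesis by (simp add: ac_simps)
      next
        case 5
        obtain K where K: "H = {#UDaimon (add_mset r X), UCut {#r, s#}, UDaimon
            (add_mset s Y)#} + K"
          "H0 = {#UDaimon (add_mset p M), UCut {#p, q#}, UDaimon (add_mset q N)#} + K"
          by (rule mset_disjoint_split[of "{#UDaimon (add_mset r X), UCut {#r, s#}, UDaimon
              (add_mset s Y)#}" H0
              "{#UDaimon (add_mset p M), UCut {#p, q#}, UDaimon (add_mset q N)#}" H])
            (use eq False 5 in auto)
        have "collapses (add_mset (UDaimon (M + N)) (add_mset (UDaimon (X + Y)) K))"
          by (rule contractibleD[OF daimon_daimon.IH _ pq(1)])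
              (use pq in \<open>auto simp: K add_mset_commute\<close>)
        then show ?thesis
          using collapses.daimon_daimon[of X Y "add_mset (UDaimon (M + N)) K" r s]
          by (simp add: K add_mset_commute)
      qed
    qed
  qed
next
  case (tensor_daimon p1 p2 Y H0 r s)
  show ?case
    unfolding contractible_def
  proof (intro allI impI)
    fix p q M N H
    assume eq: "add_mset (UTensor p1 p2 r) (add_mset (UCut {#r, s#}) (add_mset (UDaimon
        (add_mset s Y)) H0)) =
      add_mset (UDaimon (add_mset p M)) (add_mset (UCut {#p, q#}) (add_mset (UDaimon
          (add_mset q N)) H))"
      and pq: "p \<noteq> q" "{p, q} \<inter> (set_mset M \<union> set_mset N \<union> upositions H) = {}"
    have "UTensor p1 p2 r \<in># add_mset (UDaimon (add_mset p M)) (add_mset (UCut {#p, q#}) (add_mset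
        (UDaimon (add_mset q N)) H))"
      "UCut {#r, s#} \<in># add_mset (UDaimon (add_mset p M)) (add_mset (UCut {#p, q#}) (add_mset
          (UDaimon (add_mset q N)) H))"
      unfolding eq[symmetric] by simp_all
    then have rs: "r \<notin> {p, q}" "s \<notin> {p, q}" using pq by (auto simp: upositions_def add_eq_conv_ex)
    have cut: "UCut {#r, s#} \<noteq> UCut {#p, q#}" using rs by (auto simp: add_eq_conv_ex)
    consider "add_mset s Y = add_mset p M" | "add_mset s Y = add_mset q N"
      | "add_mset s Y \<noteq> add_mset p M" "add_mset s Y \<noteq> add_mset q N"
      by blast
    then show "collapses (add_mset (UDaimon (M + N)) H)"
    proof cases
      case 1
      show ?thesis
        by (rule contract_tensor_daimon[OF tensor_daimon.IH eq pq rs 1])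
    next
      case 2
      have "collapses (add_mset (UDaimon (N + M)) H)"
        by (rule contract_tensor_daimon[OF tensor_daimon.IH _ _ _ _ _ 2, of r p])
          (use eq pq rs in \<open>auto simp: add_mset_commute\<close>)
      then show ?thesis by (simp add: ac_simps)
    next
      case 3
      obtain K where K: "H = {#UTensor p1 p2 r, UCut {#r, s#}, UDaimon (add_mset s Y)#} + K"
        "H0 = {#UDaimon (add_mset p M), UCut {#p, q#}, UDaimon (add_mset q N)#} + K"
        by (rule mset_disjoint_split[of "{#UTensor p1 p2 r, UCut {#r, s#}, UDaimon
            (add_mset s Y)#}" H0
            "{#UDaimon (add_mset p M), UCut {#p, q#}, UDaimon (add_mset q N)#}" H])
          (use eq cut 3 in auto)
      let ?X = "{p, q, p1, p2} \<union> set_mset Y \<union> set_mset M \<union> set_mset N \<union> upositions K"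
      obtain q1 q2 where f: "q1 \<notin> ?X" "q2 \<notin> ?X" "q1 \<noteq> q2"
        by (rule obtain_two_fresh[of ?X]) auto
      have "collapses (add_mset (UDaimon (M + N)) (add_mset (UCut {#p1, q1#}) (add_mset
          (UCut {#p2, q2#})
          (add_mset (UDaimon (add_mset q1 (add_mset q2 Y))) K))))"
        by (rule contractibleD[OF tensor_daimon.IH[of q1 q2] _ pq(1)])
          (use pq f in \<open>auto simp: K add_mset_commute\<close>)
      then show ?thesis
        using collapses_tensor_daimon_fresh[of p1 q1 p2 q2 Y "add_mset (UDaimon (M + N)) K" r s] f
        by (simp add: K add_mset_commute)
    qed
  qed
next
  case (par_daimon q1 q2 X Y H0 r s)
  show ?case
    unfolding contractible_def
  proof (intro allI impI)
    fix p q M N H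
    assume eq: "add_mset (UPar q1 q2 r) (add_mset (UCut {#r, s#}) (add_mset (UDaimon (add_mset s
        (X + Y))) H0)) =
      add_mset (UDaimon (add_mset p M)) (add_mset (UCut {#p, q#}) (add_mset (UDaimon
          (add_mset q N)) H))"
      and pq: "p \<noteq> q" "{p, q} \<inter> (set_mset M \<union> set_mset N \<union> upositions H) = {}"
    have "UPar q1 q2 r \<in># add_mset (UDaimon (add_mset p M)) (add_mset (UCut {#p, q#}) (add_mset
        (UDaimon (add_mset q N)) H))"
      "UCut {#r, s#} \<in># add_mset (UDaimon (add_mset p M)) (add_mset (UCut {#p, q#}) (add_mset
          (UDaimon (add_mset q N)) H))"
      unfolding eq[symmetric] by simp_all
    then have rs: "r \<notin> {p, q}" "s \<notin> {p, q}" using pq by (auto simp: upositions_def add_eq_conv_ex)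
    have cut: "UCut {#r, s#} \<noteq> UCut {#p, q#}" using rs by (auto simp: add_eq_conv_ex)
    consider "add_mset s (X + Y) = add_mset p M" | "add_mset s (X + Y) = add_mset q N"
      | "add_mset s (X + Y) \<noteq> add_mset p M" "add_mset s (X + Y) \<noteq> add_mset q N"
      by blast
    then show "collapses (add_mset (UDaimon (M + N)) H)"
    proof cases
      case 1
      show ?thesis
        by (rule contract_par_daimon[OF par_daimon.IH eq pq rs 1])
    next
      case 2
      have "collapses (add_mset (UDaimon (N + M)) H)"
        by (rule contract_par_daimon[OF par_daimon.IH _ _ _ _ _ 2, of r p])
          (use eq pq rs in \<open>auto simp: add_mset_commute\<close>)
      then show ?thesis by (simp add: ac_simps)
    next
      case 3
      obtain K where K: "H = {#UPar q1 q2 r, UCut {#r, s#}, UDaimon (add_mset s (X + Y))#} + K"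
        "H0 = {#UDaimon (add_mset p M), UCut {#p, q#}, UDaimon (add_mset q N)#} + K"
        by (rule mset_disjoint_split[of "{#UPar q1 q2 r, UCut {#r, s#}, UDaimon (add_mset s
            (X + Y))#}" H0
            "{#UDaimon (add_mset p M), UCut {#p, q#}, UDaimon (add_mset q N)#}" H])
          (use eq cut 3 in auto)
      let ?X = "{p, q, q1, q2} \<union> set_mset X \<union> set_mset Y \<union> set_mset M \<union> set_mset N \<union> upositions K"
      obtain p1 p2 where f: "p1 \<notin> ?X" "p2 \<notin> ?X" "p1 \<noteq> p2"
        by (rule obtain_two_fresh[of ?X]) auto
      have "collapses (add_mset (UDaimon (M + N)) (add_mset (UCut {#q1, p1#}) (add_mset
          (UCut {#q2, p2#})
          (add_mset (UDaimon (add_mset p1 X)) (add_mset (UDaimon (add_mset p2 Y)) K)))))"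
        by (rule contractibleD[OF par_daimon.IH[of p1 p2] _ pq(1)])
          (use pq f in \<open>auto simp: K add_mset_commute\<close>)
      then show ?thesis
        using collapses_par_daimon_fresh[of q1 p1 q2 p2 X Y "add_mset (UDaimon (M + N)) K" r s] f
        by (simp add: K add_mset_commute)
    qed
  qed
qed

lemma collapses_contract:
  assumes "collapses (add_mset (UDaimon (add_mset p M)) (add_mset (UCut {#p, q#}) (add_mset (UDaimon
      (add_mset q N)) H)))"
    and "p \<noteq> q" "{p, q} \<inter> (set_mset M \<union> set_mset N \<union> upositions H) = {}"
  shows "collapses (add_mset (UDaimon (M + N)) H)"
  using contractibleD[OF collapses_contractible[OF assms(1)] refl] assms(2,3) by simp

text \<open>Steps that leave the tensor link alone are replayed. Against a par link, its reduct is
  literally that of \<open>UDaimon {#p#}\<close> split into two empty parts. Against a daimon, two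
  contractions absorb the unary daimons, which gives the reduct of the single cut with
  \<open>UDaimon {#p#}\<close>.\<close>

lemma collapses_replace_tensor:
  "collapses L \<Longrightarrow>
   L = add_mset (UTensor p1 p2 p) (add_mset (UDaimon {#p1#}) (add_mset (UDaimon {#p2#}) H)) \<Longrightarrow>
   p1 \<noteq> p2 \<Longrightarrow> {p1, p2} \<inter> insert p (upositions H) = {} \<Longrightarrow>
   collapses (add_mset (UDaimon {#p#}) H)"
proof (induction arbitrary: H rule: collapses.induct)
  case base
  then show ?case by simp
next
  case (par_tensor a b c d H0 r s)
  note eq = par_tensor.prems(1) and fr = par_tensor.prems(2,3)
  show ?case
  proof (cases "UTensor b d s = UTensor p1 p2 p")
    case True
    obtain K where K: "H = {#UPar a c r, UCut {#r, s#}#} + K"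
      "H0 = {#UDaimon {#p1#}, UDaimon {#p2#}#} + K"
      by (rule mset_disjoint_split[of "{#UPar a c r, UCut {#r, s#}#}" H0
          "{#UDaimon {#p1#}, UDaimon {#p2#}#}" H])
        (use eq True in \<open>auto simp: add_mset_commute\<close>)
    show ?thesis
      using collapses_par_daimon_fresh[of a p1 c p2 "{#}" "{#}" K r p] par_tensor.hyps True fr
      by (auto simp: K add_mset_commute)
  next
    case False
    obtain K where K: "H = {#UPar a c r, UCut {#r, s#}, UTensor b d s#} + K"
      "H0 = {#UTensor p1 p2 p, UDaimon {#p1#}, UDaimon {#p2#}#} + K"
      by (rule mset_disjoint_split[of "{#UPar a c r, UCut {#r, s#}, UTensor b d s#}" H0
          "{#UTensor p1 p2 p, UDaimon {#p1#}, UDaimon {#p2#}#}" H])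
        (use eq False in auto)
    have "collapses (add_mset (UDaimon {#p#}) (add_mset (UCut {#a, b#}) (add_mset
        (UCut {#c, d#}) K)))"
      by (rule par_tensor.IH) (use fr in \<open>auto simp: K add_mset_commute\<close>)
    then show ?thesis
      using collapses.par_tensor[of a b c d "add_mset (UDaimon {#p#}) K" r s]
      by (simp add: K add_mset_commute)
  qed
next
  case (daimon_daimon X Y H0 r s)
  note eq = daimon_daimon.prems(1) and fr = daimon_daimon.prems(2,3)
  have "UCut {#r, s#} \<in># add_mset (UTensor p1 p2 p) (add_mset (UDaimon {#p1#}) (add_mset
      (UDaimon {#p2#}) H))"
    unfolding eq[symmetric] by simp
  \<comment> \<open>While \<open>p1\<close> and \<open>p2\<close> occur only in the displayed links,
    no cut reaches the two unary daimons.\<close>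
  then have rs: "r \<notin> {p1, p2}" "s \<notin> {p1, p2}" using fr by (auto simp: upositions_def)
  obtain K where K: "H = {#UDaimon (add_mset r X), UCut {#r, s#}, UDaimon (add_mset s Y)#} + K"
    "H0 = {#UTensor p1 p2 p, UDaimon {#p1#}, UDaimon {#p2#}#} + K"
    by (rule mset_disjoint_split[of "{#UDaimon (add_mset r X), UCut {#r, s#}, UDaimon
        (add_mset s Y)#}" H0
        "{#UTensor p1 p2 p, UDaimon {#p1#}, UDaimon {#p2#}#}" H])
      (use eq rs in auto)
  have "collapses (add_mset (UDaimon {#p#}) (add_mset (UDaimon (X + Y)) K))"
    by (rule daimon_daimon.IH) (use fr in \<open>auto simp: K add_mset_commute\<close>)
  then show ?case
    using collapses.daimon_daimon[of X Y "add_mset (UDaimon {#p#}) K" r s]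
    by (simp add: K add_mset_commute)
next
  case (tensor_daimon a b Y H0 r s)
  note eq = tensor_daimon.prems(1) and fr = tensor_daimon.prems(2,3)
  have "UCut {#r, s#} \<in># add_mset (UTensor p1 p2 p) (add_mset (UDaimon {#p1#}) (add_mset
      (UDaimon {#p2#}) H))"
    unfolding eq[symmetric] by simp
  then have rs: "r \<notin> {p1, p2}" "s \<notin> {p1, p2}" using fr by (auto simp: upositions_def)
  show ?case
  proof (cases "UTensor a b r = UTensor p1 p2 p")
    case True
    obtain K where K: "H = {#UCut {#r, s#}, UDaimon (add_mset s Y)#} + K"
      "H0 = {#UDaimon {#p1#}, UDaimon {#p2#}#} + K"
      by (rule mset_disjoint_split[of "{#UCut {#r, s#}, UDaimon (add_mset s Y)#}" H0
          "{#UDaimon {#p1#}, UDaimon {#p2#}#}" H])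
        (use eq True rs in auto)
    let ?X = "{p1, p2} \<union> set_mset Y \<union> upositions K"
    obtain q1 q2 where f: "q1 \<notin> ?X" "q2 \<notin> ?X" "q1 \<noteq> q2"
      by (rule obtain_two_fresh[of ?X]) auto
    have "collapses (add_mset (UDaimon (add_mset q1 (add_mset q2 Y))) (add_mset (UCut {#q1, p1#})
        (add_mset (UDaimon (add_mset p1 {#})) (add_mset (UCut {#p2, q2#}) (add_mset
            (UDaimon {#p2#}) K)))))"
      using tensor_daimon.hyps[of q1 q2] True by (simp add: K add_mset_commute)
    then have "collapses (add_mset (UDaimon (add_mset q2 Y + {#})) (add_mset (UCut {#p2, q2#})
        (add_mset (UDaimon {#p2#}) K)))"
      by (rule collapses_contract) (use f fr in \<open>auto simp: K\<close>)
    then have "collapses (add_mset (UDaimon (add_mset q2 Y)) (add_mset (UCut {#q2, p2#}) (add_mset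
        (UDaimon (add_mset p2 {#})) K)))"
      by (simp add: add_mset_commute)
    then have "collapses (add_mset (UDaimon (Y + {#})) K)"
      by (rule collapses_contract) (use f fr in \<open>auto simp: K\<close>)
    \<comment> \<open>With the unary daimon, one \<open>daimon_daimon\<close> step already arrives
      at this hypergraph.\<close>
    then show ?thesis
      using collapses.daimon_daimon[of "{#}" Y K r s] True by (simp add: K)
  next
    case False
    obtain K where K: "H = {#UTensor a b r, UCut {#r, s#}, UDaimon (add_mset s Y)#} + K"
      "H0 = {#UTensor p1 p2 p, UDaimon {#p1#}, UDaimon {#p2#}#} + K"
      by (rule mset_disjoint_split[of "{#UTensor a b r, UCut {#r, s#}, UDaimon (add_mset s Y)#}" H0
          "{#UTensor p1 p2 p, UDaimon {#p1#}, UDaimon {#p2#}#}" H])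
        (use eq False rs in auto)
    let ?X = "{p, p1, p2, a, b} \<union> set_mset Y \<union> upositions K"
    obtain q1 q2 where f: "q1 \<notin> ?X" "q2 \<notin> ?X" "q1 \<noteq> q2"
      by (rule obtain_two_fresh[of ?X]) auto
    have "collapses (add_mset (UDaimon {#p#}) (add_mset (UCut {#a, q1#}) (add_mset (UCut {#b, q2#})
        (add_mset (UDaimon (add_mset q1 (add_mset q2 Y))) K))))"
      by (rule tensor_daimon.IH[of q1 q2]) (use fr f in \<open>auto simp: K add_mset_commute\<close>)
    then show ?thesis
      using collapses_tensor_daimon_fresh[of a q1 b q2 Y "add_mset (UDaimon {#p#}) K" r s] f
      by (simp add: K add_mset_commute)
  qed
next
  case (par_daimon a b X Y H0 r s)
  note eq = par_daimon.prems(1) and fr = par_daimon.prems(2,3)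
  have "UCut {#r, s#} \<in># add_mset (UTensor p1 p2 p) (add_mset (UDaimon {#p1#}) (add_mset
      (UDaimon {#p2#}) H))"
    unfolding eq[symmetric] by simp
  then have rs: "r \<notin> {p1, p2}" "s \<notin> {p1, p2}" using fr by (auto simp: upositions_def)
  obtain K where K: "H = {#UPar a b r, UCut {#r, s#}, UDaimon (add_mset s (X + Y))#} + K"
    "H0 = {#UTensor p1 p2 p, UDaimon {#p1#}, UDaimon {#p2#}#} + K"
    by (rule mset_disjoint_split[of "{#UPar a b r, UCut {#r, s#}, UDaimon (add_mset s (X + Y))#}" H0
        "{#UTensor p1 p2 p, UDaimon {#p1#}, UDaimon {#p2#}#}" H])
      (use eq rs in auto)
  let ?X = "{p, p1, p2, a, b} \<union> set_mset X \<union> set_mset Y \<union> upositions K"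
  obtain q1 q2 where f: "q1 \<notin> ?X" "q2 \<notin> ?X" "q1 \<noteq> q2"
    by (rule obtain_two_fresh[of ?X]) auto
  have "collapses (add_mset (UDaimon {#p#}) (add_mset (UCut {#a, q1#}) (add_mset (UCut {#b, q2#})
      (add_mset (UDaimon (add_mset q1 X)) (add_mset (UDaimon (add_mset q2 Y)) K)))))"
    by (rule par_daimon.IH[of q1 q2]) (use fr f in \<open>auto simp: K add_mset_commute\<close>)
  then show ?case
    using collapses_par_daimon_fresh[of a q1 b q2 X Y "add_mset (UDaimon {#p#}) K" r s] f
    by (simp add: K add_mset_commute)
qed

text \<open>Against a tensor link, the reduct is that of \<open>UDaimon {#p#}\<close> expanded to
  the outputs \<open>p1\<close>, \<open>p2\<close>. Against a daimon, the halves \<open>X\<close>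
  and \<open>Y\<close> are rejoined through \<open>{#p1, p2#}\<close> by two contractions, so
  whatever split the reduction chose leaves no trace.\<close>

lemma collapses_replace_par:
  "collapses L \<Longrightarrow>
   L = add_mset (UPar p1 p2 p) (add_mset (UDaimon {#p1, p2#}) H) \<Longrightarrow>
   p1 \<noteq> p2 \<Longrightarrow> {p1, p2} \<inter> insert p (upositions H) = {} \<Longrightarrow>
   collapses (add_mset (UDaimon {#p#}) H)"
proof (induction arbitrary: H rule: collapses.induct)
  case base
  then show ?case by simp
next
  case (par_tensor a b c d H0 r s)
  note eq = par_tensor.prems(1) and fr = par_tensor.prems(2,3)
  show ?case
  proof (cases "UPar a c r = UPar p1 p2 p")
    case True
    obtain K where K: "H = {#UCut {#r, s#}, UTensor b d s#} + K" "H0 = {#UDaimon {#p1, p2#}#} + K"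
      by (rule mset_disjoint_split[of "{#UCut {#r, s#}, UTensor b d s#}" H0
          "{#UDaimon {#p1, p2#}#}" H])
        (use eq True in auto)
    show ?thesis
      using collapses_tensor_daimon_fresh[of b p1 d p2 "{#}" K s r] par_tensor.hyps True fr
      by (auto simp: K add_mset_commute)
  next
    case False
    obtain K where K: "H = {#UPar a c r, UCut {#r, s#}, UTensor b d s#} + K"
      "H0 = {#UPar p1 p2 p, UDaimon {#p1, p2#}#} + K"
      by (rule mset_disjoint_split[of "{#UPar a c r, UCut {#r, s#}, UTensor b d s#}" H0
          "{#UPar p1 p2 p, UDaimon {#p1, p2#}#}" H])
        (use eq False in auto)
    have "collapses (add_mset (UDaimon {#p#}) (add_mset (UCut {#a, b#}) (add_mset
        (UCut {#c, d#}) K)))"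
      by (rule par_tensor.IH) (use fr in \<open>auto simp: K add_mset_commute\<close>)
    then show ?thesis
      using collapses.par_tensor[of a b c d "add_mset (UDaimon {#p#}) K" r s]
      by (simp add: K add_mset_commute)
  qed
next
  case (daimon_daimon X Y H0 r s)
  note eq = daimon_daimon.prems(1) and fr = daimon_daimon.prems(2,3)
  have "UCut {#r, s#} \<in># add_mset (UPar p1 p2 p) (add_mset (UDaimon {#p1, p2#}) H)"
    unfolding eq[symmetric] by simp
  then have rs: "r \<notin> {p1, p2}" "s \<notin> {p1, p2}" using fr by (auto simp: upositions_def)
  obtain K where K: "H = {#UDaimon (add_mset r X), UCut {#r, s#}, UDaimon (add_mset s Y)#} + K"
    "H0 = {#UPar p1 p2 p, UDaimon {#p1, p2#}#} + K"
    by (rule mset_disjoint_split[of "{#UDaimon (add_mset r X), UCut {#r, s#}, UDaimon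
        (add_mset s Y)#}" H0
        "{#UPar p1 p2 p, UDaimon {#p1, p2#}#}" H])
      (use eq rs in \<open>auto simp: add_eq_conv_ex\<close>)
  have "collapses (add_mset (UDaimon {#p#}) (add_mset (UDaimon (X + Y)) K))"
    by (rule daimon_daimon.IH) (use fr in \<open>auto simp: K add_mset_commute\<close>)
  then show ?case
    using collapses.daimon_daimon[of X Y "add_mset (UDaimon {#p#}) K" r s]
    by (simp add: K add_mset_commute)
next
  case (tensor_daimon a b Y H0 r s)
  note eq = tensor_daimon.prems(1) and fr = tensor_daimon.prems(2,3)
  have "UCut {#r, s#} \<in># add_mset (UPar p1 p2 p) (add_mset (UDaimon {#p1, p2#}) H)"
    unfolding eq[symmetric] by simp
  then have rs: "r \<notin> {p1, p2}" "s \<notin> {p1, p2}" using fr by (auto simp: upositions_def)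
  then have D: "add_mset s Y \<noteq> {#p1, p2#}" by (auto simp: add_eq_conv_ex)
  obtain K where K: "H = {#UTensor a b r, UCut {#r, s#}, UDaimon (add_mset s Y)#} + K"
    "H0 = {#UPar p1 p2 p, UDaimon {#p1, p2#}#} + K"
    by (rule mset_disjoint_split[of "{#UTensor a b r, UCut {#r, s#}, UDaimon (add_mset s Y)#}" H0
        "{#UPar p1 p2 p, UDaimon {#p1, p2#}#}" H])
      (use eq D in auto)
  let ?X = "{p, p1, p2, a, b} \<union> set_mset Y \<union> upositions K"
  obtain q1 q2 where f: "q1 \<notin> ?X" "q2 \<notin> ?X" "q1 \<noteq> q2"
    by (rule obtain_two_fresh[of ?X]) auto
  have "collapses (add_mset (UDaimon {#p#}) (add_mset (UCut {#a, q1#}) (add_mset (UCut {#b, q2#})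
      (add_mset (UDaimon (add_mset q1 (add_mset q2 Y))) K))))"
    by (rule tensor_daimon.IH[of q1 q2]) (use fr f in \<open>auto simp: K add_mset_commute\<close>)
  then show ?case
    using collapses_tensor_daimon_fresh[of a q1 b q2 Y "add_mset (UDaimon {#p#}) K" r s] f
    by (simp add: K add_mset_commute)
next
  case (par_daimon a b X Y H0 r s)
  note eq = par_daimon.prems(1) and fr = par_daimon.prems(2,3)
  have "UCut {#r, s#} \<in># add_mset (UPar p1 p2 p) (add_mset (UDaimon {#p1, p2#}) H)"
    unfolding eq[symmetric] by simp
  then have rs: "r \<notin> {p1, p2}" "s \<notin> {p1, p2}" using fr by (auto simp: upositions_def)
  then have D: "add_mset s (X + Y) \<noteq> {#p1, p2#}" by (auto simp: add_eq_conv_ex)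
  show ?case
  proof (cases "UPar a b r = UPar p1 p2 p")
    case True
    obtain K where K: "H = {#UCut {#r, s#}, UDaimon (add_mset s (X + Y))#} + K"
      "H0 = {#UDaimon {#p1, p2#}#} + K"
      by (rule mset_disjoint_split[of "{#UCut {#r, s#}, UDaimon (add_mset s (X + Y))#}" H0
          "{#UDaimon {#p1, p2#}#}" H])
        (use eq True D in auto)
    let ?X = "{p1, p2} \<union> set_mset X \<union> set_mset Y \<union> upositions K"
    obtain q1 q2 where f: "q1 \<notin> ?X" "q2 \<notin> ?X" "q1 \<noteq> q2"
      by (rule obtain_two_fresh[of ?X]) auto
    have "collapses (add_mset (UDaimon (add_mset q1 X)) (add_mset (UCut {#q1, p1#})
        (add_mset (UDaimon (add_mset p1 {#p2#})) (add_mset (UCut {#p2, q2#}) (add_mset (UDaimon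
            (add_mset q2 Y)) K)))))"
      \<comment> \<open>The premise itself is needed here, not the induction hypothesis: the par
        link is gone after this step.\<close>
      using par_daimon.hyps[of q1 q2] True by (simp add: K add_mset_commute)
    then have "collapses (add_mset (UDaimon (X + {#p2#})) (add_mset (UCut {#p2, q2#}) (add_mset
        (UDaimon (add_mset q2 Y)) K)))"
      by (rule collapses_contract) (use f fr in \<open>auto simp: K\<close>)
    then have "collapses (add_mset (UDaimon (add_mset p2 X)) (add_mset (UCut {#p2, q2#}) (add_mset
        (UDaimon (add_mset q2 Y)) K)))"
      by simp
    then have "collapses (add_mset (UDaimon (X + Y)) K)"
      by (rule collapses_contract) (use f fr in \<open>auto simp: K\<close>)
    then show ?thesis
      using collapses.daimon_daimon[of "{#}" "X + Y" K r s] True by (simp add: K)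
  next
    case False
    obtain K where K: "H = {#UPar a b r, UCut {#r, s#}, UDaimon (add_mset s (X + Y))#} + K"
      "H0 = {#UPar p1 p2 p, UDaimon {#p1, p2#}#} + K"
      by (rule mset_disjoint_split[of "{#UPar a b r, UCut {#r, s#}, UDaimon (add_mset s
          (X + Y))#}" H0
          "{#UPar p1 p2 p, UDaimon {#p1, p2#}#}" H])
        (use eq D False in auto)
    let ?X = "{p, p1, p2, a, b} \<union> set_mset X \<union> set_mset Y \<union> upositions K"
    obtain q1 q2 where f: "q1 \<notin> ?X" "q2 \<notin> ?X" "q1 \<noteq> q2"
      by (rule obtain_two_fresh[of ?X]) auto
    have "collapses (add_mset (UDaimon {#p#}) (add_mset (UCut {#a, q1#}) (add_mset (UCut {#b, q2#})
        (add_mset (UDaimon (add_mset q1 X)) (add_mset (UDaimon (add_mset q2 Y)) K)))))"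
      by (rule par_daimon.IH[of q1 q2]) (use fr f in \<open>auto simp: K add_mset_commute\<close>)
    then show ?thesis
      using collapses_par_daimon_fresh[of a q1 b q2 X Y "add_mset (UDaimon {#p#}) K" r s] f
      by (simp add: K add_mset_commute)
  qed
qed

section \<open>Orthogonality and nets\<close>

text \<open>\<open>f\<close> need not be injective, so the result is a hypergraph and not
  necessarily that of a net.\<close>

definition ulinks :: "(nat \<Rightarrow> nat) \<Rightarrow> net \<Rightarrow> nat ulink multiset" where
  "ulinks f S = image_mset (\<lambda>l. unord (map_link f l)) (links S)"

text \<open>Zipping stops at the shorter list, which matches the \<open>min\<close> in
  \<open>interaction\<close>.\<close>

definition ucuts :: "nat list \<Rightarrow> nat list \<Rightarrow> nat ulink multiset" where
  "ucuts ps qs = mset (map2 (\<lambda>p q. UCut {#p, q#}) ps qs)"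

lemma ucuts_simps [simp]:
  "ucuts [] qs = {#}" "ucuts ps [] = {#}"
  "ucuts (p # ps) (q # qs) = add_mset (UCut {#p, q#}) (ucuts ps qs)"
  by (simp_all add: ucuts_def)

lemma ucuts_commute: "ucuts ps qs = ucuts qs ps"
  by (induction ps qs rule: list_induct2') (simp_all add: add_mset_commute)

lemma map_ulink_ulinks: "image_mset (map_ulink g) (ulinks f S) = ulinks (g \<circ> f) S"
  by (simp add: ulinks_def multiset.map_comp comp_def unord_map_link ulink.map_comp)

lemma map_ulink_ucuts: "image_mset (map_ulink g) (ucuts ps qs) = ucuts (map g ps) (map g qs)"
  by (induction ps qs rule: list_induct2') simp_all

lemma set_link: "set_link l = set (source l) \<union> set (target l)"
  by (cases l) auto

lemma ulinks_cong: "(\<And>p. p \<in> positions (links S) \<Longrightarrow> f p = g p) \<Longrightarrow> ulinks f S = ulinks g S"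
  unfolding ulinks_def
  by (intro image_mset_cong arg_cong[of _ _ unord] link.map_cong0)
      (auto simp: positions_def set_link)

text \<open>
  Undoes the separation into even and odd positions: any two renamings of the sides of an
  interaction are combined into one renaming of the whole.
\<close>

definition interleave :: "(nat \<Rightarrow> nat) \<Rightarrow> (nat \<Rightarrow> nat) \<Rightarrow> nat \<Rightarrow> nat" where
  "interleave f g n = (if even n then f (n div 2) else g (n div 2))"

lemma interleave_simps [simp]:
  "interleave f g (2 * n) = f n" "interleave f g (Suc (2 * n)) = g n"
  by (simp_all add: interleave_def)

lemma ulinks_interaction:
  "ulinks f (interaction S T) =
     ulinks (\<lambda>n. f (2 * n)) S + ulinks (\<lambda>n. f (Suc (2 * n))) T
     + ucuts (map (\<lambda>n. f (2 * n)) (concl S)) (map (\<lambda>n. f (Suc (2 * n))) (concl T))"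
proof -
  have "image_mset (\<lambda>l. unord (map_link f l)) (mset (map2 CutL (take k ps) (take k qs))) =
      ucuts (map f ps) (map f qs)" if "k = min (length ps) (length qs)" for k ps qs
    using that by (induction ps qs arbitrary: k rule: list_induct2') auto
  from this[of _ "map (\<lambda>n. 2 * n) (concl S)" "map (\<lambda>n. Suc (2 * n)) (concl T)"] show ?thesis
    unfolding interaction_def Let_def
    by (simp add: ulinks_def rename_def comp_def multiset.map_comp link.map_comp)
qed

lemma net_steps_iff:
  "net_step\<^sup>*\<^sup>* S T \<longleftrightarrow> cut_step\<^sup>*\<^sup>* (links S) (links T) \<and> concl T = concl S"
proof
  assume "net_step\<^sup>*\<^sup>* S T"
  then show "cut_step\<^sup>*\<^sup>* (links S) (links T) \<and> concl T = concl S"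
    by induction (auto simp: net_step_def intro: rtranclp.rtrancl_into_rtrancl)
next
  have "net_step\<^sup>*\<^sup>* (Net L c) (Net K c)" if "cut_step\<^sup>*\<^sup>* L K" for L K c
    using that
  proof induction
    case (step K' K'')
    then have "net_step (Net K' c) (Net K'' c)" by (simp add: net_step_def)
    with step.IH show ?case by (rule rtranclp.rtrancl_into_rtrancl)
  qed simp
  then show "net_step\<^sup>*\<^sup>* S T" if "cut_step\<^sup>*\<^sup>* (links S) (links T) \<and> concl T = concl S"
    using that by (metis net.collapse)
qed

lemma collapses_ulinks_interaction:
  assumes "collapses (ulinks id (interaction S T))"
  shows "collapses (ulinks f S + ulinks g T + ucuts (map f (concl S)) (map g (concl T)))"
  using collapses_map[OF assms, of "interleave f g"]
  by (simp add: ulinks_interaction map_ulink_ulinks map_ulink_ucuts comp_def)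

lemma ulinks_id: "ulinks id S = image_mset unord (links S)"
  by (simp add: ulinks_def link.map_id)

text \<open>Interleaving \<open>f\<close> and \<open>g\<close> carries a collapse of the interaction
  to any two renamings of its sides, even overlapping ones; the maps to even and odd positions give
  the interaction back. Lengths agree because steps keep conclusions and \<open>daimon 0\<close> has
  none.\<close>

lemma orth_iff:
  "orth S T \<longleftrightarrow> nconcl S = nconcl T \<and>
     (\<forall>f g. collapses (ulinks f S + ulinks g T + ucuts (map f (concl S)) (map g (concl T))))"
proof -
  have "orth S T \<longleftrightarrow> nconcl S = nconcl T \<and> collapses (ulinks id (interaction S T))"
    unfolding orth_def net_steps_iff ulinks_id collapses_iff_cut_steps
    by (auto simp: daimon_def interaction_def Let_def rename_def)
  moreover have "collapses (ulinks id (interaction S T))"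
    if "\<forall>f g. collapses (ulinks f S + ulinks g T + ucuts (map f (concl S)) (map g (concl T)))"
    using that[rule_format, of "\<lambda>n. 2 * n" "\<lambda>n. Suc (2 * n)"] by (simp add: ulinks_interaction)
  ultimately show ?thesis
    using collapses_ulinks_interaction by blast
qed

lemma orth_sym: "orth S T \<Longrightarrow> orth T S"
  by (metis orth_iff ucuts_commute union_commute)

section \<open>Nets are closed under the constructions of the proof\<close>

lemma is_net_disjoint_union:
  assumes "is_net S" "is_net T" and disj: "positions (links S) \<inter> positions (links T) = {}"
  shows "is_net (Net (links S + links T) (concl S @ concl T))"
proof -
  have pos: "positions (links S + links T) = positions (links S) \<union> positions (links T)"
    by (auto simp: positions_def)
  have src: "set (source l) \<subseteq> positions L" and tgt: "set (target l) \<subseteq> positions L"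
    if "l \<in># L" for l and L :: "nat link multiset"
    using that by (auto simp: positions_def)
  have e1: "{#l \<in># L. p \<in> set (target l)#} = {#}" "{#l \<in># L. p \<in> set (source l)#} = {#}"
    if "p \<notin> positions L" for p and L :: "nat link multiset"
    using that by (auto simp: positions_def)
  show ?thesis
    unfolding is_net_def net.sel
  proof (intro conjI ballI)
    show "distinct (source l @ target l)" if "l \<in># links S + links T" for l
      using that assms by (auto simp: is_net_def)
    fix p assume p: "p \<in> positions (links S + links T)"
    with disj consider "p \<in> positions (links S)" "p \<notin> positions (links T)"
      | "p \<in> positions (links T)" "p \<notin> positions (links S)"
      unfolding pos by blast
    then have "size {#l \<in># links S + links T. p \<in> set (target l)#} = 1 \<and>
      size {#l \<in># links S + links T. p \<in> set (source l)#} \<le> 1"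
      using assms by cases (simp_all add: is_net_def e1)
    then show "size {#l \<in># links S + links T. p \<in> set (target l)#} = 1"
      "size {#l \<in># links S + links T. p \<in> set (source l)#} \<le> 1"
      by blast+
  next
    show "distinct (concl S @ concl T)"
      using assms by (auto simp: is_net_def)
    show "set (concl S @ concl T) =
      {p \<in> positions (links S + links T). \<forall>l\<in>#links S + links T. p \<notin> set (source l)}"
      using assms src[of _ "links S"] src[of _ "links T"] unfolding pos is_net_def by auto blast+
  qed
qed

text \<open>Stated for a general link so that it serves tensor, par and cut links alike, with the
  order of the conclusions left open.\<close>

lemma is_net_add_link:
  assumes net: "is_net S" and l: "distinct (source l @ target l)" "set (source l) \<subseteq> set (concl S)"
    and tgt: "set (target l) \<inter> positions (links S) = {}"
    and c: "distinct c" "set c = (set (concl S) - set (source l)) \<union> set (target l)"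
  shows "is_net (Net (add_mset l (links S)) c)"
proof -
  have concl: "set (concl S) = {p \<in> positions (links S). \<forall>l\<in>#links S. p \<notin> set (source l)}"
    using net by (simp add: is_net_def)
  have pos: "positions (add_mset l (links S)) = positions (links S) \<union> set (target l)"
    using l(2) concl by (auto simp: positions_def)
  show ?thesis
    unfolding is_net_def net.sel
  proof (intro conjI ballI)
    show "distinct (source k @ target k)" if "k \<in># add_mset l (links S)" for k
      using that net l by (auto simp: is_net_def)
    fix p assume p: "p \<in> positions (add_mset l (links S))"
    have new: "{#k \<in># links S. p \<in> set (target k)#} = {#}"
        "{#k \<in># links S. p \<in> set (source k)#} = {#}"
      if "p \<in> set (target l)"
      using that tgt by (auto simp: positions_def)
    show "size {#k \<in># add_mset l (links S). p \<in> set (target k)#} = 1"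
    proof (cases "p \<in> set (target l)")
      case False
      then show ?thesis using p pos net by (auto simp: is_net_def)
    qed (simp add: new)
    show "size {#k \<in># add_mset l (links S). p \<in> set (source k)#} \<le> 1"
    proof (cases "p \<in> set (source l)")
      case True
      \<comment> \<open>An input of \<open>l\<close> was a conclusion, hence is in the source of no
        earlier link.\<close>
      then have "{#k \<in># links S. p \<in> set (source k)#} = {#}"
        using l(2) concl by auto
      note empty = this
      show ?thesis by (simp add: empty True)
    next
      case False
      show ?thesis
      proof (cases "p \<in> set (target l)")
        case True
        with False show ?thesis by (simp add: new)
      next
        case False
        with \<open>p \<notin> set (source l)\<close> show ?thesis using p pos net by (auto simp: is_net_def)
      qed
    qed
  next
    show "distinct c" by fact
    show "set c = {p \<in> positions (add_mset l (links S)). \<forall>l\<in>#add_mset l (links S). p \<notin> set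
        (source l)}"
      unfolding c(2) pos concl using l(1) tgt by (auto simp: positions_def)
  qed
qed

lemma is_net_parallel:
  assumes "is_net S" "is_net T"
  shows "is_net (parallel S T)"
proof -
  have "is_net (to_left S)" "is_net (to_right T)"
    using assms by (auto intro!: is_net_rename simp: inj_on_def)
  moreover have "positions (links (to_left S)) \<inter> positions (links (to_right T)) = {}"
    by (auto simp: rename_def positions_rename) presburger
  ultimately show ?thesis
    unfolding parallel_def by (rule is_net_disjoint_union)
qed

lemma is_net_interaction:
  assumes "is_net S" "is_net T" "concl S = p # ps" "concl T = [q]"
  shows "is_net (interaction S T)"
proof -
  have "interaction S T = Net (add_mset (CutL (2 * p) (2 * q + 1)) (links (parallel S T))) (map
      (\<lambda>n. 2 * n) ps)"
    using assms(3,4) by (simp add: interaction_def parallel_def rename_def)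
  moreover have "distinct ps" "p \<notin> set ps"
    using assms by (auto simp: is_net_def)
  ultimately show ?thesis
    using is_net_parallel[OF assms(1,2)]
    by (simp, intro is_net_add_link) (auto simp: parallel_def rename_def assms(3,4) distinct_map
        inj_on_def, presburger+)
qed

lemma is_net_daimon_link: "distinct ps \<Longrightarrow> is_net (Net {#DaimonL ps#} ps)"
  by (auto simp: is_net_def positions_def)

lemma is_net_daimon: "is_net (daimon n)"
  by (simp add: daimon_def is_net_daimon_link)

lemma represents_is_net: "represents S \<pi> \<Longrightarrow> is_net S"
proof (induction rule: represents.induct)
  case (daimon ps \<Gamma>)
  then show ?case by (simp add: is_net_daimon_link)
next
  case (par S \<pi> ps p1 p2 p)
  then have "distinct (concl S)" "set (concl S) \<subseteq> positions (links S)" by (auto simp: is_net_def)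
  with par show ?case by (intro is_net_add_link) auto
next
  case (tensor S \<pi> T \<rho> ps p1 qs p2 p)
  have "set (concl S) \<subseteq> positions (links S)" "set (concl T) \<subseteq> positions (links T)"
    "distinct (concl S)" "distinct (concl T)"
    using tensor by (auto simp: is_net_def)
  with tensor.hyps have "distinct (ps @ qs @ [p1, p2, p])"
    "p \<notin> positions (links S + links T)"
    by (auto simp: positions_def)
  with tensor.hyps show ?case
    using is_net_add_link[OF is_net_disjoint_union[OF tensor.IH tensor.hyps(3)],
        of "TensorL p1 p2 p" "ps @ qs @ [p]"]
    by auto
next
  case (cut S \<pi> T \<rho> ps p1 qs p2)
  have "set (concl S) \<subseteq> positions (links S)" "set (concl T) \<subseteq> positions (links T)"
    "distinct (concl S)" "distinct (concl T)"
    using cut by (auto simp: is_net_def)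
  with cut.hyps have "distinct (ps @ qs @ [p1, p2])"
    by auto
  with cut.hyps show ?case
    using is_net_add_link[OF is_net_disjoint_union[OF cut.IH cut.hyps(3)],
        of "CutL p1 p2" "ps @ qs"]
    by auto
next
  case (ex S \<pi> ps p1 p2 qs)
  then show ?case by (auto simp: is_net_def)
qed

section \<open>Types and realisers\<close>

lemma polar_antimono: "A \<subseteq> B \<Longrightarrow> polar B \<subseteq> polar A"
  by (auto simp: polar_def)

lemma subset_bipolar: "(\<And>S. S \<in> A \<Longrightarrow> is_net S) \<Longrightarrow> A \<subseteq> polar (polar A)"
  by (auto simp: polar_def intro: orth_sym)

lemma is_type_polar: "is_type (polar (polar A))"
  unfolding is_type_def
proof
  show "polar (polar A) \<subseteq> polar (polar (polar (polar A)))"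
    by (rule subset_bipolar) (simp add: polar_def)
  have "polar A \<subseteq> polar (polar (polar A))"
    by (rule subset_bipolar) (simp add: polar_def)
  then show "polar (polar (polar (polar A))) \<subseteq> polar (polar A)"
    by (rule polar_antimono)
qed

lemma is_type_is_net: "is_type A \<Longrightarrow> S \<in> A \<Longrightarrow> is_net S"
  unfolding is_type_def by (metis (no_types, lifting) mem_Collect_eq polar_def)

lemma ulinks_daimon: "ulinks f (daimon n) = {#UDaimon (mset (map f [0..<n]))#}"
  by (simp add: ulinks_def daimon_def)

lemma nconcl_daimon [simp]: "nconcl (daimon n) = n"
  by (simp add: daimon_def)

text \<open>\<open>A'\<close> stands for the interpretation of the negation; an inclusion in the
  polar is what a basis guarantees. The two daimons make \<open>A\<close> and \<open>polar A\<close>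
  nonempty, so the arity condition of \<open>comp_type\<close> is active.\<close>

definition dual_types :: "net set \<Rightarrow> net set \<Rightarrow> bool" where
  "dual_types A A' \<longleftrightarrow> is_type A \<and> is_type A' \<and> daimon 1 \<in> A \<and> daimon 1 \<in> A' \<and> A' \<subseteq> polar A"

lemma dual_types_sym: "dual_types A A' \<Longrightarrow> dual_types A' A"
  by (auto simp: dual_types_def polar_def intro: orth_sym is_type_is_net)

text \<open>Each of these nets is orthogonal to a unary daimon from the other side, and orthogonal
  nets have equally many conclusions.\<close>

lemma dual_types_nconcl:
  assumes "dual_types A A'"
  shows "S \<in> A \<Longrightarrow> nconcl S = 1" "T \<in> polar A \<Longrightarrow> nconcl T = 1"
  using assms orth_iff unfolding dual_types_def polar_def
  by (metis (no_types, lifting) mem_Collect_eq nconcl_daimon orth_iff subset_iff)+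

lemma dual_types_type_arity: "dual_types A A' \<Longrightarrow> type_arity A = 1"
  unfolding type_arity_def
  by (rule the_equality) (use dual_types_nconcl(1) in \<open>auto simp: dual_types_def\<close>)

text \<open>Each test net has its own arbitrary renaming \<open>g\<close>, so tests may overlap with
  each other and with the tested net. Collapsing tolerates this, and no disjointness has to be
  maintained.\<close>

fun tests :: "net set list \<Rightarrow> nat list \<Rightarrow> nat ulink multiset set" where
  "tests [] [] = {{#}}"
| "tests (A # As) (p # ps) =
     {add_mset (UCut {#p, g q#}) (ulinks g T + E) |g q T E. T \<in> polar A \<and> concl T = [q]
         \<and> E \<in> tests As ps}"
| "tests _ _ = {}"

lemma tests_ConsI:
  "T \<in> polar A \<Longrightarrow> concl T = [q] \<Longrightarrow> E \<in> tests As ps \<Longrightarrow>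
   add_mset (UCut {#p, g q#}) (ulinks g T + E) \<in> tests (A # As) (p # ps)"
  by auto

lemma tests_append:
  "length As = length ps \<Longrightarrow>
   tests (As @ Bs) (ps @ qs) = {E + F |E F. E \<in> tests As ps \<and> F \<in> tests Bs qs}"
proof (induction As ps rule: list_induct2)
  case (Cons A As p ps)
  show ?case
  proof (intro set_eqI iffI)
    fix X assume "X \<in> tests ((A # As) @ Bs) ((p # ps) @ qs)"
    then obtain g q T E F where *: "X = add_mset (UCut {#p, g q#}) (ulinks g T + (E + F))"
        "T \<in> polar A"
      "concl T = [q]" "E \<in> tests As ps" "F \<in> tests Bs qs"
      using Cons by auto
    then have "X = add_mset (UCut {#p, g q#}) (ulinks g T + E) + F" by (simp add: ac_simps)
    moreover have "add_mset (UCut {#p, g q#}) (ulinks g T + E) \<in> tests (A # As) (p # ps)"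
      using *(2-4) by (rule tests_ConsI)
    ultimately show "X \<in> {E + F |E F. E \<in> tests (A # As) (p # ps) \<and> F \<in> tests Bs qs}"
      using *(5) by blast
  next
    fix X assume "X \<in> {E + F |E F. E \<in> tests (A # As) (p # ps) \<and> F \<in> tests Bs qs}"
    then obtain g q T E F where *: "X = add_mset (UCut {#p, g q#}) (ulinks g T + E) + F"
        "T \<in> polar A"
      "concl T = [q]" "E \<in> tests As ps" "F \<in> tests Bs qs"
      by auto
    then have "X = add_mset (UCut {#p, g q#}) (ulinks g T + (E + F))" by (simp add: ac_simps)
    moreover have "E + F \<in> tests (As @ Bs) (ps @ qs)" using * Cons by auto
    ultimately show "X \<in> tests ((A # As) @ Bs) ((p # ps) @ qs)"
      using tests_ConsI[OF *(2,3)] by simp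
  qed
qed simp

text \<open>The length is demanded separately because lists of different lengths have no tests,
  which would make the second condition vacuous.\<close>

definition realises :: "net set list \<Rightarrow> net \<Rightarrow> bool" where
  "realises As S \<longleftrightarrow> nconcl S = length As \<and>
     (\<forall>f. \<forall>E\<in>tests As (map f (concl S)). collapses (ulinks f S + E))"

lemma concl_interaction:
  "concl S = p # ps \<Longrightarrow> concl T = [q] \<Longrightarrow> concl (interaction S T) = map (\<lambda>n. 2 * n) ps"
  by (simp add: interaction_def rename_def)

text \<open>The counterpart of \<open>comp_type\<close>: interacting with \<open>T\<close> plugs the
  first test, and a renaming of the interaction amounts to one renaming for \<open>S\<close> and one
  for \<open>T\<close>.\<close>

lemma realises_Cons:
  assumes A: "dual_types A A'" and S: "concl S = p # ps"
  shows "realises (A # As) S \<longleftrightarrow> (\<forall>T\<in>polar A. realises As (interaction S T))"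
proof (intro iffI ballI)
  fix T assume R: "realises (A # As) S" and T: "T \<in> polar A"
  obtain q where q: "concl T = [q]"
    using dual_types_nconcl(2)[OF A T] by (auto simp: length_Suc_conv)
  show "realises As (interaction S T)"
    unfolding realises_def concl_interaction[OF S q]
  proof (intro conjI allI ballI)
    show "length (map (\<lambda>n. 2 * n) ps) = length As" using R S by (simp add: realises_def)
    fix f E assume E: "E \<in> tests As (map f (map (\<lambda>n. 2 * n) ps))"
    let ?f = "\<lambda>n. f (2 * n)" and ?g = "\<lambda>n. f (Suc (2 * n))"
    have "add_mset (UCut {#?f p, ?g q#}) (ulinks ?g T + E) \<in> tests (A # As) (map ?f (concl S))"
      using tests_ConsI[OF T q, of E As "map ?f ps"
          "?f p" ?g] E S by (simp add: comp_def del: tests.simps)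
    then have "collapses (ulinks ?f S + add_mset (UCut {#?f p, ?g q#}) (ulinks ?g T + E))"
      using R unfolding realises_def by blast
    then show "collapses (ulinks f (interaction S T) + E)"
      by (simp add: ulinks_interaction S q union_ac)
  qed
next
  assume R: "\<forall>T\<in>polar A. realises As (interaction S T)"
  show "realises (A # As) S"
    unfolding realises_def
  proof (intro conjI allI ballI)
    \<comment> \<open>Some test exists, so the number of conclusions of \<open>S\<close> can be read
      off one interaction.\<close>
    from A obtain T where T: "T \<in> polar A" by (auto simp: dual_types_def)
    obtain q where q: "concl T = [q]"
      using dual_types_nconcl(2)[OF A T] by (auto simp: length_Suc_conv)
    show "nconcl S = length (A # As)"
      using R T concl_interaction[OF S q] by (auto simp: realises_def S)
  next
    fix f E assume "E \<in> tests (A # As) (map f (concl S))"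
    then obtain g q T F where *: "E = add_mset (UCut {#f p, g q#}) (ulinks g T + F)" "T \<in> polar A"
      "concl T = [q]" "F \<in> tests As (map f ps)"
      by (auto simp: S)
    \<comment> \<open>\<open>interleave f g\<close> undoes the move to even and odd positions, so
      \<open>F\<close> is attached at the same places as before.\<close>
    have "F \<in> tests As (map (interleave f g) (concl (interaction S T)))"
      using * S by (simp add: concl_interaction comp_def)
    then have "collapses (ulinks (interleave f g) (interaction S T) + F)"
      using R *(2) by (auto simp: realises_def)
    then show "collapses (ulinks f S + E)"
      by (simp add: ulinks_interaction S *(1,3) union_ac)
  qed
qed

fun seq_type :: "net set list \<Rightarrow> net set" where
  "seq_type [] = polar {Net {#} []}"
| "seq_type [A] = A"
| "seq_type (A # B # As) = comp_type A (seq_type (B # As))"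

lemma interp_seq_eq: "interp_seq \<B> \<Gamma> = seq_type (map (interp \<B>) \<Gamma>)"
  by (induction \<B> \<Gamma> rule: interp_seq.induct) simp_all

text \<open>The only test for the empty sequent is the empty hypergraph, and a single type is its
  own bipolar. Each further type is one use of \<open>realises_Cons\<close>, where the arity
  condition excludes nets without conclusions.\<close>

lemma seq_type_iff:
  "list_all2 dual_types As As' \<Longrightarrow> S \<in> seq_type As \<longleftrightarrow> is_net S \<and> realises As S"
proof (induction As arbitrary: S As' rule: seq_type.induct)
  case 1
  have "ulinks f (Net {#} []) = {#}" for f by (simp add: ulinks_def)
  then show ?case by (auto simp: polar_def orth_iff realises_def)
next
  case (2 A)
  then obtain A' where A: "dual_types A A'" by (auto simp: list_all2_Cons1)
  then have "S \<in> A \<longleftrightarrow> is_net S \<and> nconcl S = 1 \<and> (\<forall>T\<in>polar A. orth S T)"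
  proof -
    have "S \<in> polar (polar A) \<longleftrightarrow> is_net S \<and> (\<forall>T\<in>polar A. orth S T)"
      by (simp add: polar_def[of "polar A"])
    moreover have "polar (polar A) = A"
      using A by (simp add: dual_types_def is_type_def)
    ultimately show ?thesis
      using dual_types_nconcl(1)[OF A, of S] by auto
  qed
  also have "\<dots> \<longleftrightarrow> is_net S \<and> realises [A] S"
  proof (intro conj_cong refl iffI; (elim conjE)?)
    assume "nconcl S = 1" "\<forall>T\<in>polar A. orth S T"
    moreover from this obtain p where "concl S = [p]" by (auto simp: length_Suc_conv)
    ultimately show "realises [A] S"
      by (auto simp: realises_def orth_iff)
  next
    assume R: "realises [A] S"
    then obtain p where p: "concl S = [p]" by (auto simp: realises_def length_Suc_conv)
    have "orth S T" if T: "T \<in> polar A" for T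
    proof -
      obtain q where q: "concl T = [q]"
        using dual_types_nconcl(2)[OF A T] by (auto simp: length_Suc_conv)
      have "collapses (ulinks f S + add_mset (UCut {#f p, g q#}) (ulinks g T + {#}))" for f g
      proof -
        have "add_mset (UCut {#f p, g q#}) (ulinks g T + {#}) \<in> tests [A] (map f (concl S))"
          unfolding p list.map by (intro tests_ConsI T q) simp
        then show ?thesis using R unfolding realises_def by blast
      qed
      then show ?thesis by (simp add: orth_iff p q)
    qed
    with p show "nconcl S = 1 \<and> (\<forall>T\<in>polar A. orth S T)" by simp
  qed
  finally show ?case by simp
next
  case (3 A B As)
  then obtain A' Bs' where A: "dual_types A A'" "list_all2 dual_types (B # As) Bs'"
    by (auto simp: list_all2_Cons1)
  have ne: "A \<noteq> {}" "polar A \<noteq> {}" using A(1) by (auto simp: dual_types_def)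
  show ?case
  proof (cases "concl S")
    case Nil
    then show ?thesis
      using ne by (auto simp: comp_type_def dual_types_type_arity[OF A(1)] realises_def)
  next
    case (Cons p ps)
    have "is_net (interaction S T)" if "is_net S" "T \<in> polar A" for T
    proof -
      obtain q where q: "concl T = [q]"
        using dual_types_nconcl(2)[OF A(1)] \<open>T \<in> polar A\<close> by (auto simp: length_Suc_conv)
      show ?thesis
        using that is_net_interaction[OF _ _ Cons q] by (auto simp: polar_def)
    qed
    then show ?thesis
      using ne Cons "3.IH"[OF A(2)]
      by (auto simp: comp_type_def dual_types_type_arity[OF A(1)] realises_Cons[OF A(1) Cons])
  qed
qed

text \<open>Membership in a type concerns nets, while \<open>ulinks f S + E\<close> may have
  overlapping parts. Interacting with the test nets one by one produces a genuine net
  \<open>W\<close>, and \<open>h\<close> maps it onto that hypergraph.\<close>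

lemma realises_absorb:
  "list_all2 dual_types As As' \<Longrightarrow> is_net S \<Longrightarrow> realises (As @ Bs) S \<Longrightarrow> concl S = ps @ qs \<Longrightarrow>
   length ps = length As \<Longrightarrow> E \<in> tests As (map f ps) \<Longrightarrow>
   \<exists>W h. is_net W \<and> realises Bs W \<and> ulinks h W = ulinks f S + E \<and> map h (concl W) = map f qs"
proof (induction As arbitrary: As' S ps qs f E)
  case Nil
  then show ?case by (auto intro!: exI[of _ S] exI[of _ f])
next
  case (Cons A As)
  then obtain A' Bs' where A: "dual_types A A'" "list_all2 dual_types As Bs'"
    by (auto simp: list_all2_Cons1)
  obtain p ps' where ps: "ps = p # ps'" using Cons.prems by (auto simp: length_Suc_conv)
  then have S: "concl S = p # (ps' @ qs)" using Cons.prems by simp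
  from Cons.prems(6) obtain g q T F where E: "E = add_mset (UCut {#f p, g q#}) (ulinks g T + F)"
      "T \<in> polar A"
    "concl T = [q]" "F \<in> tests As (map f ps')"
    by (auto simp: ps)
  have "is_net (interaction S T)"
    using is_net_interaction[OF Cons.prems(2) _ S E(3)] E(2) by (simp add: polar_def)
  moreover have "realises (As @ Bs) (interaction S T)"
    using Cons.prems(3) realises_Cons[OF A(1) S] E(2) by simp
  moreover have "concl (interaction S T) = map (\<lambda>n. 2 * n) ps' @ map (\<lambda>n. 2 * n) qs"
    using concl_interaction[OF S E(3)] by simp
  moreover have "F \<in> tests As (map (interleave f g) (map (\<lambda>n. 2 * n) ps'))"
    using E(4) by (simp add: comp_def)
  ultimately obtain W h where W: "is_net W" "realises Bs W"
    "ulinks h W = ulinks (interleave f g) (interaction S T) + F"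
    "map h (concl W) = map (interleave f g) (map (\<lambda>n. 2 * n) qs)"
    using Cons.IH[OF A(2), of "interaction S T" "map (\<lambda>n. 2 * n) ps'" "map (\<lambda>n. 2 * n) qs"
        F "interleave f g"] Cons.prems(5) ps
    by auto
  from W(3) have "ulinks h W = ulinks f S + E"
    by (simp add: ulinks_interaction S E union_ac)
  with W show ?case by (auto simp: comp_def)
qed

lemma collapses_daimon_tests:
  "list_all2 dual_types As As' \<Longrightarrow> E \<in> tests As ps \<Longrightarrow> collapses (add_mset (UDaimon (mset ps)) E)"
proof (induction As ps arbitrary: As' E rule: tests.induct)
  case (2 A As p ps)
  then obtain A' Bs' where A: "dual_types A A'" "list_all2 dual_types As Bs'"
    by (auto simp: list_all2_Cons1)
  from "2.prems"(2) obtain g q T F where E: "E = add_mset (UCut {#p, g q#}) (ulinks g T + F)"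
      "T \<in> polar A"
    "concl T = [q]" "F \<in> tests As ps"
    by auto
  have "orth T (daimon 1)" using A(1) E(2) by (auto simp: dual_types_def polar_def)
  \<comment> \<open>The constant renaming places the single output of \<open>daimon 1\<close> at
    \<open>p\<close>.\<close>
  then have "collapses (ulinks g T + ulinks (\<lambda>_. p) (daimon 1) + ucuts (map g (concl T)) (map
      (\<lambda>_. p) (concl (daimon 1))))"
    unfolding orth_iff by blast
  then have "collapses (add_mset (UDaimon {#p#}) (add_mset (UCut {#p, g q#}) (ulinks g T)))"
    unfolding ulinks_daimon E(3) by (simp add: daimon_def add_mset_commute)
  from collapses_merge[OF this refl "2.IH"[OF A(2) E(4)]] show ?case
    by (simp add: E(1))
qed (auto simp: collapses.base)

lemma realises_daimon_link:
  assumes "list_all2 dual_types As As'" "length ps = length As"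
  shows "realises As (Net {#DaimonL ps#} ps)"
  using collapses_daimon_tests[OF assms(1), of _ "map f ps" for f] assms(2)
  by (simp add: realises_def ulinks_def)

section \<open>Tensor and par of types\<close>

lemma parallel_memI:
  assumes "is_type A" "is_type B" "S \<in> A" "T \<in> B"
  shows "parallel S T \<in> parallel_type A B"
proof -
  have "{parallel S T |S T. S \<in> A \<and> T \<in> B} \<subseteq> parallel_type A B"
    unfolding parallel_type_def
    by (rule subset_bipolar) (use assms(1,2) in \<open>auto intro!: is_net_parallel intro:
        is_type_is_net\<close>)
  with assms(3,4) show ?thesis by blast
qed

lemma is_net_concl_positions: "is_net S \<Longrightarrow> set (concl S) \<subseteq> positions (links S)"
  by (auto simp: is_net_def)

lemma is_net_connective:
  assumes "is_net S" "concl S = p1 # p2 # ps" "p \<notin> positions (links S)"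
    and "source l = [p1, p2]" "target l = [p]"
  shows "is_net (Net (add_mset l (links S)) (p # ps))"
proof (rule is_net_add_link)
  have d: "distinct (concl S)" "set (concl S) \<subseteq> positions (links S)"
    using assms(1) by (auto simp: is_net_def)
  then show "distinct (source l @ target l)" "distinct (p # ps)"
    "set (p # ps) = set (concl S) - set (source l) \<union> set (target l)"
    using assms by auto
qed (use assms in auto)

definition tensor_nets :: "net set \<Rightarrow> net set \<Rightarrow> net set" where
  "tensor_nets A B = {Net (add_mset (TensorL p1 p2 p) (links S)) (p # ps) |S p1 p2 ps p.
        S \<in> parallel_type A B \<and> concl S = p1 # p2 # ps \<and> p \<notin> positions (links S)}"

definition par_nets :: "net set \<Rightarrow> net set \<Rightarrow> net set" where
  "par_nets A B = {Net (add_mset (ParL p1 p2 p) (links S)) (p # ps) |S p1 p2 ps p.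
        S \<in> comp_type A B \<and> concl S = p1 # p2 # ps \<and> p \<notin> positions (links S)}"

lemma tensor_netsI:
  "S \<in> parallel_type A B \<Longrightarrow> concl S = p1 # p2 # ps \<Longrightarrow> p \<notin> positions (links S) \<Longrightarrow>
   Net (add_mset (TensorL p1 p2 p) (links S)) (p # ps) \<in> tensor_nets A B"
  unfolding tensor_nets_def by blast

lemma par_netsI:
  "S \<in> comp_type A B \<Longrightarrow> concl S = p1 # p2 # ps \<Longrightarrow> p \<notin> positions (links S) \<Longrightarrow>
   Net (add_mset (ParL p1 p2 p) (links S)) (p # ps) \<in> par_nets A B"
  unfolding par_nets_def by blast

lemma tensor_type_eq: "tensor_type A B = polar (polar (tensor_nets A B))"
  by (simp add: tensor_type_def tensor_nets_def)

lemma par_type_eq: "par_type A B = polar (polar (par_nets A B))"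
  by (simp add: par_type_def par_nets_def)

lemma tensor_nets_is_net: "S \<in> tensor_nets A B \<Longrightarrow> is_net S"
  by (auto simp: tensor_nets_def parallel_type_def polar_def[of
      "polar _"] intro!: is_net_connective)

lemma par_nets_is_net: "S \<in> par_nets A B \<Longrightarrow> is_net S"
  by (auto simp: par_nets_def comp_type_def intro!: is_net_connective)

lemma tensor_nets_subset: "tensor_nets A B \<subseteq> tensor_type A B"
  unfolding tensor_type_eq by (rule subset_bipolar) (rule tensor_nets_is_net)

lemma par_nets_subset: "par_nets A B \<subseteq> par_type A B"
  unfolding par_type_eq by (rule subset_bipolar) (rule par_nets_is_net)

lemma comp_type_iff:
  assumes "dual_types A A'" "dual_types B B'"
  shows "S \<in> comp_type A B \<longleftrightarrow> is_net S \<and> realises [A, B] S"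
  using seq_type_iff[of "[A, B]" "[A', B']" S] assms by simp

lemma ulinks_parallel:
  "ulinks f (parallel S T) = ulinks (\<lambda>n. f (2 * n)) S + ulinks (\<lambda>n. f (Suc (2 * n))) T"
  by (simp add: ulinks_def parallel_def rename_def multiset.map_comp comp_def link.map_comp)

lemma concl_parallel:
  "map f (concl (parallel S T)) = map (\<lambda>n. f (2 * n)) (concl S) @ map (\<lambda>n. f (Suc (2 * n)))
      (concl T)"
  by (simp add: parallel_def rename_def)

text \<open>A net orthogonal to all generators \<open>parallel U V\<close> is orthogonal to their
  bipolar. On a generator, \<open>U\<close> and \<open>V\<close> themselves form a test for
  \<open>S\<close>, because \<open>A \<subseteq> polar A'\<close> and
  \<open>B \<subseteq> polar B'\<close>.\<close>

lemma orth_comp_parallel: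
  assumes A: "dual_types A A'" and B: "dual_types B B'"
    and S: "S \<in> comp_type A' B'" and T: "T \<in> parallel_type A B"
  shows "orth S T"
proof -
  note A' = dual_types_sym[OF A] and B' = dual_types_sym[OF B]
  have R: "is_net S" "realises [A', B'] S"
    using S comp_type_iff[OF A' B'] by auto
  then obtain p1 p2 where p: "concl S = [p1, p2]" by (auto simp: realises_def length_Suc_conv)
  have "orth S (parallel U V)" if UV: "U \<in> A" "V \<in> B" for U V
  proof -
    obtain u v where uv: "concl U = [u]" "concl V = [v]"
      using dual_types_nconcl(1)[OF A UV(1)] dual_types_nconcl(1)[OF B UV(2)]
      by (auto simp: length_Suc_conv)
    have pol: "U \<in> polar A'" "V \<in> polar B'" using A' B' UV by (auto simp: dual_types_def)
    have len: "nconcl (parallel U V) = 2" using uv by (simp add: parallel_def rename_def)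
    have "collapses (ulinks f S + ulinks g (parallel U V) + ucuts (map f (concl S)) (map g (concl
        (parallel U V))))" for f g
    proof -
      let ?g1 = "\<lambda>n. g (2 * n)" and ?g2 = "\<lambda>n. g (Suc (2 * n))"
      have "add_mset (UCut {#f p1, ?g1 u#}) (ulinks ?g1 U + add_mset (UCut {#f p2, ?g2 v#})
          (ulinks ?g2 V + {#}))
          \<in> tests [A', B'] (map f (concl S))"
        unfolding p list.map by (intro tests_ConsI pol uv) simp
      then have "collapses (ulinks f S + add_mset (UCut {#f p1, ?g1 u#}) (ulinks ?g1 U + add_mset
          (UCut {#f p2, ?g2 v#}) (ulinks ?g2 V + {#})))"
        using R(2) unfolding realises_def by blast
      then show ?thesis
        by (simp add: ulinks_parallel concl_parallel p uv ac_simps add_mset_commute)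
    qed
    then show ?thesis using len p by (simp add: orth_iff)
  qed
  then have "S \<in> polar {parallel S T |S T. S \<in> A \<and> T \<in> B}"
    using R(1) by (auto simp: polar_def)
  with T have "orth T S" by (auto simp: parallel_type_def polar_def[of "polar _"])
  then show ?thesis by (rule orth_sym)
qed

text \<open>The cut between the two connectives reduces in one step to the first two cuts between
  \<open>S\<close> and \<open>T\<close>.\<close>

lemma orth_par_tensor:
  assumes "orth S T" "concl S = p1 # p2 # ps" "concl T = q1 # q2 # qs"
  shows "orth (Net (add_mset (ParL p1 p2 p) (links S)) (p # ps))
    (Net (add_mset (TensorL q1 q2 q) (links T)) (q # qs))"
proof -
  have "collapses (add_mset (UPar (f p1) (f p2) (f p)) (ulinks f S) + add_mset (UTensor (g q1)
      (g q2) (g q)) (ulinks g T)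
      + ucuts (map f (p # ps)) (map g (q # qs)))" for f g
  proof -
    have "collapses (ulinks f S + ulinks g T + ucuts (map f (concl S)) (map g (concl T)))"
      using assms(1) by (simp add: orth_iff)
    then show ?thesis
      using collapses.par_tensor[of "f p1" "g q1" "f p2" "g q2"
          "ulinks f S + ulinks g T + ucuts (map f ps) (map g qs)" "f p" "g q"]
        assms(2,3)
      by (simp add: ac_simps add_mset_commute)
  qed
  moreover have "length ps = length qs" using assms by (simp add: orth_iff)
  ultimately show ?thesis by (simp add: orth_iff ulinks_def)
qed

lemma par_type_subset_polar:
  assumes A: "dual_types A A'" and B: "dual_types B B'"
  shows "par_type A' B' \<subseteq> polar (tensor_type A B)"
proof -
  have "par_nets A' B' \<subseteq> polar (tensor_nets A B)"
  proof
    fix P assume P: "P \<in> par_nets A' B'"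
    have "orth P Q" if "Q \<in> tensor_nets A B" for Q
      using P that orth_par_tensor orth_comp_parallel[OF A B]
      unfolding par_nets_def tensor_nets_def by blast
    with par_nets_is_net[OF P] show "P \<in> polar (tensor_nets A B)" by (simp add: polar_def)
  qed
  then show ?thesis
    \<comment> \<open>Antitonicity applied twice lifts the inclusion of generators to the bipolar on
      the left and the triple polar on the right.\<close>
    unfolding par_type_eq tensor_type_eq by (intro polar_antimono)
qed

lemma daimon_mem_tensor_type:
  assumes A: "dual_types A A'" and B: "dual_types B B'"
  shows "daimon 1 \<in> tensor_type A B"
proof -
  let ?D = "parallel (daimon 1) (daimon 1)"
  \<comment> \<open>\<open>parallel\<close> puts the two outputs at the even position 0 and the odd
    position 1, and 2 is fresh.\<close>
  let ?Y = "Net (add_mset (TensorL 0 1 2) (links ?D)) [2]"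
  have D: "links ?D = {#DaimonL [0], DaimonL [1]#}" "concl ?D = [0, 1]"
    by (simp_all add: parallel_def rename_def daimon_def)
  have "?D \<in> parallel_type A B"
    using A B by (intro parallel_memI) (auto simp: dual_types_def)
  then have Y: "?Y \<in> tensor_nets A B"
    by (rule tensor_netsI) (simp_all add: D positions_def del: One_nat_def)
  have "orth (daimon 1) P" if "P \<in> polar (tensor_nets A B)" for P
  proof -
    have orth: "orth P ?Y" using that Y by (auto simp: polar_def)
    then obtain r where r: "concl P = [r]" by (auto simp: orth_iff length_Suc_conv)
    have "collapses (add_mset (UDaimon {#f 0#}) (add_mset (UCut {#f 0, g r#}) (ulinks g P)))"
      for f g :: "nat \<Rightarrow> nat"
    proof -
      obtain a b where ab: "a \<notin> insert (f 0) (insert (g r) (upositions (ulinks g P)))"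
        "b \<notin> insert (f 0) (insert (g r) (upositions (ulinks g P)))" "a \<noteq> b"
        by (rule obtain_two_fresh[of "insert (f 0) (insert (g r) (upositions (ulinks g P)))"]) auto
      \<comment> \<open>The inputs 0 and 1 go to fresh positions, as the simulation requires; the
        output 2 goes to the position of the unary daimon that will replace the net.\<close>
      define h where "h = (\<lambda>n :: nat. if n = 0 then a else if n = 1 then b else f 0)"
      have "collapses (ulinks g P + ulinks h ?Y + ucuts (map g (concl P)) (map h (concl ?Y)))"
        using orth unfolding orth_iff by blast
      then have "collapses (add_mset (UTensor a b (f 0)) (add_mset (UDaimon {#a#}) (add_mset
          (UDaimon {#b#})
          (add_mset (UCut {#f 0, g r#}) (ulinks g P)))))"
        by (simp add: ulinks_def D r h_def add_mset_commute del: One_nat_def)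
      then show ?thesis
        by (rule collapses_replace_tensor[OF _ refl]) (use ab in auto)
    qed
    then show ?thesis
      using r by (simp add: orth_iff ulinks_daimon) (simp add: daimon_def)
  qed
  then show ?thesis
    by (simp add: tensor_type_eq polar_def[of "polar _"] is_net_daimon)
qed

lemma daimon_mem_par_type:
  assumes A: "dual_types A A'" and B: "dual_types B B'"
  shows "daimon 1 \<in> par_type A B"
proof -
  let ?D = "Net {#DaimonL [0, 1]#} [0, 1]"
  let ?Y = "Net (add_mset (ParL 0 1 2) (links ?D)) [2]"
  \<comment> \<open>This is the daimon rule for the two-formula sequent.\<close>
  have "?D \<in> comp_type A B"
    using realises_daimon_link[of "[A, B]" "[A', B']" "[0, 1]"] A B
    by (simp add: comp_type_iff[OF A B] is_net_daimon_link)
  then have Y: "?Y \<in> par_nets A B"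
    using par_netsI[of ?D A B 0 1 "[]" 2] by (simp add: positions_def)
  have "orth (daimon 1) P" if "P \<in> polar (par_nets A B)" for P
  proof -
    have orth: "orth P ?Y" using that Y by (auto simp: polar_def)
    then obtain r where r: "concl P = [r]" by (auto simp: orth_iff length_Suc_conv)
    have "collapses (add_mset (UDaimon {#f 0#}) (add_mset (UCut {#f 0, g r#}) (ulinks g P)))"
      for f g :: "nat \<Rightarrow> nat"
    proof -
      obtain a b where ab: "a \<notin> insert (f 0) (insert (g r) (upositions (ulinks g P)))"
        "b \<notin> insert (f 0) (insert (g r) (upositions (ulinks g P)))" "a \<noteq> b"
        by (rule obtain_two_fresh[of "insert (f 0) (insert (g r) (upositions (ulinks g P)))"]) auto
      define h where "h = (\<lambda>n :: nat. if n = 0 then a else if n = 1 then b else f 0)"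
      have "collapses (ulinks g P + ulinks h ?Y + ucuts (map g (concl P)) (map h (concl ?Y)))"
        using orth unfolding orth_iff by blast
      then have "collapses (add_mset (UPar a b (f 0)) (add_mset (UDaimon {#a, b#})
          (add_mset (UCut {#f 0, g r#}) (ulinks g P))))"
        by (simp add: ulinks_def r h_def add_mset_commute)
      then show ?thesis
        by (rule collapses_replace_par[OF _ refl]) (use ab in auto)
    qed
    then show ?thesis
      using r by (simp add: orth_iff ulinks_daimon) (simp add: daimon_def)
  qed
  then show ?thesis
    by (simp add: par_type_eq polar_def[of "polar _"] is_net_daimon)
qed

lemma dual_types_tensor_par:
  assumes A: "dual_types A A'" and B: "dual_types B B'"
  shows "dual_types (tensor_type A B) (par_type A' B')"
  using daimon_mem_tensor_type[OF A B] par_type_subset_polar[OF A B]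
    daimon_mem_par_type[OF dual_types_sym[OF A] dual_types_sym[OF B]]
  by (simp add: dual_types_def tensor_type_eq par_type_eq is_type_polar)

text \<open>The variable case uses approximability at both \<open>X\<close> and
  \<open>dual X\<close>; the par case is the tensor case for the negations, read backwards by
  symmetry.\<close>

lemma dual_types_interp:
  assumes "interpretation_basis dual \<B>" "approximable \<B>"
  shows "dual_types (interp \<B> A) (interp \<B> (neg dual A))"
proof (induction A)
  case (Var X)
  then show ?case
    using assms by (simp add: dual_types_def interpretation_basis_def approximable_def)
next
  case (Par A B)
  then show ?case
    by (simp add: dual_types_sym dual_types_tensor_par)
next
  case (Tensor A B)
  then show ?case
    by (simp add: dual_types_tensor_par)
qed

section \<open>Soundness of the rules\<close>

lemma realises_par:
  assumes G: "list_all2 dual_types Gs Gs'" and A: "dual_types A A'" and B: "dual_types B B'"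
    and S: "is_net S" "realises (Gs @ [A, B]) S" "concl S = ps @ [p1, p2]" "p \<notin> positions (links S)"
  shows "realises (Gs @ [par_type A B]) (Net (add_mset (ParL p1 p2 p) (links S)) (ps @ [p]))"
  unfolding realises_def
proof (intro conjI allI ballI)
  have len: "length ps = length Gs" using S by (simp add: realises_def)
  then show "nconcl (Net (add_mset (ParL p1 p2 p) (links S)) (ps @ [p]))
      = length (Gs @ [par_type A B])"
    by simp
  fix f X assume "X \<in> tests (Gs @ [par_type A B]) (map f (concl (Net (add_mset (ParL p1 p2 p)
      (links S)) (ps @ [p]))))"
  then obtain E g q T where X: "X = E + add_mset (UCut {#f p, g q#}) (ulinks g T)"
    "E \<in> tests Gs (map f ps)" "T \<in> polar (par_type A B)" "concl T = [q]"
    using len by (auto simp: tests_append)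
  obtain W h where W: "is_net W" "realises [A, B] W" "ulinks h W = ulinks f S + E"
    "map h (concl W) = map f [p1, p2]"
    using realises_absorb[OF G S(1,2,3) len X(2)] by blast
  then obtain w1 w2 where w: "concl W = [w1, w2]" "h w1 = f p1" "h w2 = f p2"
    by (auto simp: map_eq_Cons_conv)
  obtain w where fresh: "w \<notin> positions (links W)"
    using ex_new_if_finite[of "positions (links W)"] by auto
  let ?V = "Net (add_mset (ParL w1 w2 w) (links W)) [w]"
  have "W \<in> comp_type A B" using W comp_type_iff[OF A B] by simp
  then have "?V \<in> par_type A B"
    using par_nets_subset[of A B] w(1) fresh unfolding par_nets_def by blast
  then have "orth T ?V" using X(3) by (auto simp: polar_def)
  then have "orth ?V T" by (rule orth_sym)
  \<comment> \<open>Sending the new output \<open>w\<close> to \<open>f p\<close> makes the image of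
    \<open>?V\<close> the given net together with the tests \<open>E\<close> for its
    context.\<close>
  let ?h = "h(w := f p)"
  have "collapses (ulinks ?h ?V + ulinks g T + ucuts (map ?h (concl ?V)) (map g (concl T)))"
    using \<open>orth ?V T\<close> unfolding orth_iff by blast
  moreover have "ulinks ?h W = ulinks h W"
    using fresh by (intro ulinks_cong) auto
  moreover have "w1 \<noteq> w" "w2 \<noteq> w"
    using is_net_concl_positions[OF W(1)] w(1) fresh by auto
  ultimately show "collapses (ulinks f (Net (add_mset (ParL p1 p2 p) (links S)) (ps @ [p])) + X)"
    using w X(1,4) W(3) by (simp add: ulinks_def add_mset_commute union_ac)
qed

lemma realises_tensor:
  assumes G: "list_all2 dual_types Gs Gs'" and A: "dual_types A A'"
    and D: "list_all2 dual_types Ds Ds'" and B: "dual_types B B'"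
    and S: "is_net S" "realises (Gs @ [A]) S" "concl S = ps @ [p1]"
    and T: "is_net T" "realises (Ds @ [B]) T" "concl T = qs @ [p2]"
  shows "realises (Gs @ Ds @ [tensor_type A B])
    (Net (add_mset (TensorL p1 p2 p) (links S + links T)) (ps @ qs @ [p]))"
  unfolding realises_def
proof (intro conjI allI ballI)
  let ?N = "Net (add_mset (TensorL p1 p2 p) (links S + links T)) (ps @ qs @ [p])"
  have len: "length ps = length Gs" "length qs = length Ds"
    using S T by (simp_all add: realises_def)
  then show "nconcl ?N = length (Gs @ Ds @ [tensor_type A B])"
    by simp
  fix f X assume "X \<in> tests (Gs @ Ds @ [tensor_type A B]) (map f (concl ?N))"
  then obtain E F g r R where X: "X = E + (F + add_mset (UCut {#f p, g r#}) (ulinks g R))"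
    "E \<in> tests Gs (map f ps)" "F \<in> tests Ds (map f qs)" "R \<in> polar (tensor_type A B)"
        "concl R = [r]"
    using len by (auto simp: tests_append)
  obtain U h where U: "is_net U" "realises [A] U" "ulinks h U = ulinks f S + E"
      "map h (concl U) = map f [p1]"
    using realises_absorb[OF G S len(1) X(2)] by blast
  obtain V k where V: "is_net V" "realises [B] V" "ulinks k V = ulinks f T + F"
      "map k (concl V) = map f [p2]"
    using realises_absorb[OF D T len(2) X(3)] by blast
  obtain u where u: "concl U = [u]" "h u = f p1" using U(4) by (auto simp: map_eq_Cons_conv)
  obtain v where v: "concl V = [v]" "k v = f p2" using V(4) by (auto simp: map_eq_Cons_conv)
  let ?P = "parallel U V"
  have P: "concl ?P = [2 * u, Suc (2 * v)]" by (simp add: parallel_def rename_def u v)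
  obtain w where fresh: "w \<notin> positions (links ?P)"
    using ex_new_if_finite[of "positions (links ?P)"] by auto
  let ?V = "Net (add_mset (TensorL (2 * u) (Suc (2 * v)) w) (links ?P)) [w]"
  have "U \<in> A" "V \<in> B"
    using seq_type_iff[of "[A]" "[A']"] seq_type_iff[of "[B]" "[B']"] A B U V by simp_all
  then have "?P \<in> parallel_type A B"
    using A B by (intro parallel_memI) (auto simp: dual_types_def)
  then have "?V \<in> tensor_type A B"
    using tensor_nets_subset[of A B] P fresh unfolding tensor_nets_def by blast
  then have "orth R ?V" using X(4) by (auto simp: polar_def)
  then have "orth ?V R" by (rule orth_sym)
  \<comment> \<open>\<open>interleave h k\<close> brings the two halves of \<open>?P\<close> back
    over \<open>S\<close> and \<open>T\<close>, and the new output goes to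
    \<open>f p\<close>.\<close>
  let ?h = "(interleave h k)(w := f p)"
  have "collapses (ulinks ?h ?V + ulinks g R + ucuts (map ?h (concl ?V)) (map g (concl R)))"
    using \<open>orth ?V R\<close> unfolding orth_iff by blast
  moreover have "ulinks ?h ?P = ulinks (interleave h k) ?P"
    using fresh by (intro ulinks_cong) auto
  moreover have "ulinks (interleave h k) ?P = ulinks f S + E + (ulinks f T + F)"
    using U V by (simp add: ulinks_parallel)
  moreover have "2 * u \<noteq> w" "Suc (2 * v) \<noteq> w"
    using is_net_concl_positions[OF is_net_parallel[OF U(1) V(1)]] P fresh by auto
  moreover have "ulinks ?h ?V = add_mset (UTensor (?h (2 * u)) (?h (Suc (2 * v))) (?h w))
      (ulinks ?h ?P)"
    by (simp add: ulinks_def)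
  ultimately show "collapses (ulinks f ?N + X)"
    using u v X(1,5) by (simp add: ulinks_def[of f
        "?N"] ulinks_def[of f S] ulinks_def[of f T] add_mset_commute union_ac)
qed

lemma realises_cut:
  assumes G: "list_all2 dual_types Gs Gs'" and A: "dual_types A A'" and D:
      "list_all2 dual_types Ds Ds'"
    and S: "is_net S" "realises (Gs @ [A]) S" "concl S = ps @ [p1]"
    and T: "is_net T" "realises (Ds @ [A']) T" "concl T = qs @ [p2]"
  shows "realises (Gs @ Ds) (Net (add_mset (CutL p1 p2) (links S + links T)) (ps @ qs))"
  unfolding realises_def
proof (intro conjI allI ballI)
  let ?N = "Net (add_mset (CutL p1 p2) (links S + links T)) (ps @ qs)"
  have len: "length ps = length Gs" "length qs = length Ds"
    using S T by (simp_all add: realises_def)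
  then show "nconcl ?N = length (Gs @ Ds)"
    by simp
  fix f X assume "X \<in> tests (Gs @ Ds) (map f (concl ?N))"
  then obtain E F where X: "X = E + F" "E \<in> tests Gs (map f ps)" "F \<in> tests Ds (map f qs)"
    using len by (auto simp: tests_append)
  obtain U h where U: "is_net U" "realises [A] U" "ulinks h U = ulinks f S + E"
      "map h (concl U) = map f [p1]"
    using realises_absorb[OF G S len(1) X(2)] by blast
  obtain V k where V: "is_net V" "realises [A'] V" "ulinks k V = ulinks f T + F"
      "map k (concl V) = map f [p2]"
    using realises_absorb[OF D T len(2) X(3)] by blast
  have "U \<in> A" "V \<in> A'"
    using seq_type_iff[of "[A]" "[A']"] seq_type_iff[of "[A']" "[A]"] A dual_types_sym[OF A] U V
    by simp_all
  then have "V \<in> polar A" using A by (auto simp: dual_types_def)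
  with \<open>U \<in> A\<close> have "orth V U" by (simp add: polar_def)
  \<comment> \<open>The single cut here is the image of the cut link on \<open>p1\<close>,
    \<open>p2\<close>; the tests are already inside \<open>U\<close> and \<open>V\<close>.\<close>
  then have "collapses (ulinks k V + ulinks h U + ucuts (map k (concl V)) (map h (concl U)))"
    unfolding orth_iff by blast
  then show "collapses (ulinks f ?N + X)"
    unfolding U(3,4) V(3,4) X(1)
    by (simp add: ulinks_def[of f "?N"] ulinks_def[of f S] ulinks_def[of f T] add_mset_commute
        union_ac)
qed

lemma tests_swap:
  "tests (A # B # As) (p # q # ps) \<subseteq> tests (B # A # As) (q # p # ps)"
proof
  fix X assume "X \<in> tests (A # B # As) (p # q # ps)"
  then obtain g a T h b U E where
    "X = add_mset (UCut {#p, g a#}) (ulinks g T + add_mset (UCut {#q, h b#}) (ulinks h U + E))"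
    and *: "T \<in> polar A" "concl T = [a]" "U \<in> polar B" "concl U = [b]" "E \<in> tests As ps"
    by auto
  then have "X = add_mset (UCut {#q, h b#}) (ulinks h U + add_mset (UCut {#p, g a#})
      (ulinks g T + E))"
    by (simp add: union_ac add_mset_commute)
  then show "X \<in> tests (B # A # As) (q # p # ps)"
    using tests_ConsI[OF *(3,4) tests_ConsI[OF *(1,2,5)]] by simp
qed

lemma realises_exchange:
  assumes "realises (Gs @ [A, B] @ Ds) S" "concl S = ps @ [p1, p2] @ qs" "length ps = length Gs"
  shows "realises (Gs @ [B, A] @ Ds) (Net (links S) (ps @ [p2, p1] @ qs))"
  unfolding realises_def
proof (intro conjI allI ballI)
  show "nconcl (Net (links S) (ps @ [p2, p1] @ qs)) = length (Gs @ [B, A] @ Ds)"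
    using assms by (simp add: realises_def)
  fix f X assume "X \<in> tests (Gs @ [B, A] @ Ds) (map f (concl (Net (links S) (ps @ [p2, p1] @ qs))))"
  then have "X \<in> tests (Gs @ (B # A # Ds)) (map f ps @ (f p2 # f p1 # map f qs))"
    by simp
  then have "X \<in> tests (Gs @ (A # B # Ds)) (map f ps @ (f p1 # f p2 # map f qs))"
    using tests_append[of Gs "map f ps" "B # A # Ds" "f p2 # f p1 # map f qs"]
      tests_append[of Gs "map f ps" "A # B # Ds" "f p1 # f p2 # map f qs"] assms(3)
      tests_swap[of B A Ds "f p2" "f p1" "map f qs"]
    by (simp del: tests.simps) blast
  then show "collapses (ulinks f (Net (links S) (ps @ [p2, p1] @ qs)) + X)"
    using assms(1,2) by (simp add: realises_def ulinks_def del: tests.simps)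
qed

lemma list_all2_dual_types_interp:
  assumes "interpretation_basis dual \<B>" "approximable \<B>"
  shows "list_all2 dual_types (map (interp \<B>) \<Gamma>) (map (interp \<B>) (map (neg dual) \<Gamma>))"
  by (simp add: list_all2_conv_all_nth dual_types_interp[OF assms])

lemma represents_realises:
  assumes basis: "interpretation_basis dual \<B>" "approximable \<B>"
  shows "represents S \<pi> \<Longrightarrow> proof_of dual \<pi> \<Gamma> \<Longrightarrow> realises (map (interp \<B>) \<Gamma>) S"
proof (induction arbitrary: \<Gamma> rule: represents.induct)
  note types = list_all2_dual_types_interp[OF basis] and type = dual_types_interp[OF basis]
  {
    case (daimon ps \<Delta>)
    then have "\<Gamma> = \<Delta>" by (auto elim: proof_of.cases)
    with daimon show ?case by (intro realises_daimon_link[OF types]) simp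
  next
    case (par S \<pi> ps p1 p2 p)
    from par.prems obtain \<Delta> A B where G: "\<Gamma> = \<Delta> @ [form.Par A B]" "proof_of dual \<pi> (\<Delta> @ [A, B])"
      by (auto elim: proof_of.cases)
    show ?case
      using realises_par[OF types type type represents_is_net[OF par.hyps(1)] _ par.hyps(2,3)]
        par.IH[OF G(2)] G(1) by simp
  next
    case (tensor S \<pi> T \<rho> ps p1 qs p2 p)
    from tensor.prems obtain \<Gamma>1 \<Gamma>2 A B where G: "\<Gamma> = \<Gamma>1 @ \<Gamma>2 @ [form.Tensor A B]"
      "proof_of dual \<pi> (\<Gamma>1 @ [A])" "proof_of dual \<rho> (\<Gamma>2 @ [B])"
      by (auto elim: proof_of.cases)
    show ?case
      using realises_tensor[OF types type types type represents_is_net[OF tensor.hyps(1)] _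
          tensor.hyps(4)
          represents_is_net[OF tensor.hyps(2)] _ tensor.hyps(5)]
        tensor.IH(1)[OF G(2)] tensor.IH(2)[OF G(3)] G(1) by simp
  next
    case (cut S \<pi> T \<rho> ps p1 qs p2)
    from cut.prems obtain \<Gamma>1 \<Gamma>2 A where G: "\<Gamma> = \<Gamma>1 @ \<Gamma>2"
      "proof_of dual \<pi> (\<Gamma>1 @ [A])" "proof_of dual \<rho> (\<Gamma>2 @ [neg dual A])"
      by (auto elim: proof_of.cases)
    show ?case
      using realises_cut[OF types type types represents_is_net[OF cut.hyps(1)] _ cut.hyps(4)
          represents_is_net[OF cut.hyps(2)] _ cut.hyps(5)]
        cut.IH(1)[OF G(2)] cut.IH(2)[OF G(3)] G(1) by simp
  next
    case (ex S \<pi> ps p1 p2 qs)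
    \<comment> \<open>The number stored in \<open>ExR\<close> is what aligns the exchanged formulas
      with the exchanged conclusions.\<close>
    from ex.prems obtain \<Gamma>1 \<Gamma>2 A B where G: "\<Gamma> = \<Gamma>1 @ [B, A] @ \<Gamma>2" "length \<Gamma>1 = length ps"
      "proof_of dual \<pi> (\<Gamma>1 @ [A, B] @ \<Gamma>2)"
      by (auto elim: proof_of.cases)
    show ?case
      using realises_exchange[OF _ ex.hyps(2), of "map (interp \<B>) \<Gamma>1"] ex.IH[OF G(3)] G(1,2) by simp
  }
qed

theorem theorem64:
  fixes dual :: "'v::countable \<Rightarrow> 'v"
    and \<B> :: "'v \<Rightarrow> net set"
    and S :: net
    and \<Gamma> :: "'v form list"
  assumes "\<And>X. dual (dual X) = X"
    and "interpretation_basis dual \<B>"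
    and "approximable \<B>"
    and "is_net S"
    and "mll_daimon dual S \<Gamma>"
  shows "S \<in> interp_seq \<B> \<Gamma>"
  using assms represents_realises[OF assms(2,3)] list_all2_dual_types_interp[OF assms(2,3), of \<Gamma>]
  by (auto simp: mll_daimon_def interp_seq_eq seq_type_iff)

end
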